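(* Let $\{X^k\}$ and $\{\bm\epsilon^k\}$ be generated by the EIRNRI algorithm described in the context, and let $\mathcal I^*$, $\mathcal Z^*$ be the index sets such that $\mathcal I(X^k)=\mathcal I^*$ and $\mathcal Z(X^k)=\mathcal Z^*$ for all sufficiently large $k$ (such sets exist). Then: (i) The perturbations $\{\epsilon_i^k\}_{i\in\mathcal I(X^k)}$ and the perturbed singular values $\{\sigma_i(X^k)+\epsilon_i^k\}_{i\in[m]}$ are all in strictly descending order (in $i$) for $k\in\mathbb{N}$, while $\{\epsilon_i^k\}_{i\in\mathcal Z(X^k)}$ are in non-increasing order for $k\in\mathbb{N}$. Consequently, for all $k\in\mathbb{N}$, the non-strictly ascending order constraint on the weights, $0<w_1^k\le w_2^k\le\dots\le w_m^k$, is automatically satisfied. (ii) There exists $\hat k\in\mathbb{N}$ such that for all $k\ge\hat k$ the update $\epsilon_i^{k+1}=\mu\epsilon_i^k$ with $\mu\in(0,1)$ is always triggered for every $i\in\mathcal I^*$. Consequently, for each $i\in\mathcal I^*$ the sequence $\{\epsilon_i^k\}$ converges monotonically to $0$, i.e. $\epsilon_i^k\to0$ as $k\to+\infty$. (iii) There exists $\hat k\in\mathbb{N}$ such that for all $k\ge\hat k$ the update (reduction) of $\epsilon_i^k$, $i\in\mathcal Z(X^k)$, is never triggered; that is, $\epsilon_i^k\equiv\epsilon_i^{\hat k}$ after some $\hat k$, for all $i\in\mathcal Z^*$. Consequently, for each $i\in\mathcal Z^*$, the sequence $\{\epsilon_i^k\}$ converges to a fixed positive constant, being equal to it for all sufficiently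 large $k$.
   Context: Problem and assumptions. $m\le n$, $p\in(0,1)$, $\lambda>0$; $\sigma_1(X)\ge\dots\ge\sigma_m(X)\ge0$ are the singular values of $X\in\mathbb{R}^{m\times n}$; $F(X)=f(X)+\lambda\sum_{i=1}^m\sigma_i(X)^p$ is the objective to be minimized, where $f:\mathbb{R}^{m\times n}\to\mathbb{R}$ is twice continuously differentiable and $L_f$-smooth, i.e. $\|\nabla f(X)-\nabla f(Y)\|_F\le L_f\|X-Y\|_F$ for all $X,Y$ ($L_f\ge0$). $F$ is level-bounded, i.e. $F(X)\to+\infty$ as $\|X\|\to\infty$ (so $F$ is bounded below and has a minimizer). $[m]=\{1,\dots,m\}$; $\mathcal I(X)=\{i\in[m]:\sigma_i(X)>0\}$, $\mathcal Z(X)=\{i\in[m]:\sigma_i(X)=0\}$. EIRNRI algorithm. Fix $\beta>L_f$, $\mu\in(0,1)$, $X^{-1}=X^0\in\mathbb{R}^{m\times n}$, $\bm\epsilon^0\in\mathbb{R}^m$ with positive, non-increasingly ordered entries, and $\bar\alpha$ chosen by the rule: $\bar\alpha\in(0,1)$ if $f$ is convex and $L_f$-smooth; $\bar\alpha\in\big(0,\sqrt{\beta/(\beta+3L_f)}\big)$ if $f$ is $L_f$-smooth. For $k=0,1,2,\dots$: choose $\alpha_k\in[0,\bar\alpha]$; set $w_i^k=p(\sigma_i(X^k)+\epsilon_i^k)^{p-1}$, $i\in[m]$; set $Y^k=X^k+\alpha_k(X^k-X^{k-1})$; let $X^{k+1}$ be a global minimizer over $X\in\mathbb{R}^{m\times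 n}$ of $f(Y^k)+\langle X,\nabla f(Y^k)\rangle+\frac\beta2\|X-Y^k\|_F^2+\frac\beta2\|X-X^k\|_F^2+\lambda\sum_{i=1}^m w_i^k\sigma_i(X)$ (when $0<w_1^k\le\dots\le w_m^k$, a global minimizer is $U^{k+1}\mathrm{diag}\big(\big[\Sigma_i^{k+1}-\frac{\lambda w_i^k}{2\beta}\big]_+\big)(V^{k+1})^\top$, where $U^{k+1}\mathrm{diag}(\Sigma^{k+1})(V^{k+1})^\top$ is the singular value decomposition of $\frac{X^k+Y^k}{2}-\frac{\nabla f(Y^k)}{2\beta}$); then update $\bm\epsilon^k$ to $\bm\epsilon^{k+1}$ as follows. Update of $\bm\epsilon$. Write $r=|\mathcal I(X^k)|$, $r^+=|\mathcal I(X^{k+1})|$. Case $\mathcal I(X^{k+1})\subsetneq\mathcal I(X^k)$: $\epsilon_i^{k+1}=\mu\epsilon_i^k$ for $i\in\mathcal I(X^{k+1})$; put $\tau_1=\sigma_{r^+}(X^{k+1})+\epsilon_{r^+}^{k+1}$, $\tau_2=\epsilon_{r^++1}^k$; for $i\in\mathcal I(X^k)\setminus\mathcal I(X^{k+1})$ set $\epsilon_i^{k+1}=\epsilon_i^k$ if $\tau_1\ge\tau_2$, and $\epsilon_i^{k+1}=\min(\epsilon_i^k,\mu\tau_1)$ otherwise; put $\tau_3=\epsilon_r^{k+1}$ and set $\epsilon_i^{k+1}=\min\{\epsilon_i^k,\tau_3\}$ for $i\in\mathcal Z(X^k)$. Case $\mathcal I(X^k)\subsetneq\mathcal I(X^{k+1})$: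 $\epsilon_i^{k+1}=\mu\epsilon_i^k$ for $i\in\mathcal I(X^k)$; put $\tau_3=\epsilon_r^k$ and set $\epsilon_i^{k+1}=\mu\min\{\epsilon_i^k,\tau_3\}$ for $i\in\mathcal I(X^{k+1})\setminus\mathcal I(X^k)$; put $\tau_1=\sigma_{r^+}(X^{k+1})+\epsilon_{r^+}^{k+1}$, $\tau_2=\epsilon^k_{r^++1}$; for $i\in\mathcal Z(X^{k+1})$ set $\epsilon_i^{k+1}=\epsilon_i^k$ if $\tau_1\ge\tau_2$, and $\min(\epsilon_i^k,\mu\tau_1)$ otherwise. Case $\mathcal I(X^k)=\mathcal I(X^{k+1})$: $\epsilon_i^{k+1}=\mu\epsilon_i^k$ for $i\in\mathcal I(X^{k+1})$; put $\tau_1=\sigma_{r^+}(X^{k+1})+\epsilon_{r^+}^{k+1}$, $\tau_2=\epsilon^k_{r^++1}$; for $i\in\mathcal Z(X^{k+1})$ set $\epsilon_i^{k+1}=\epsilon_i^k$ if $\tau_1\ge\tau_2$, and $\min(\epsilon_i^k,\mu\tau_1)$ otherwise.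
   Formalization: In (i), "strictly descending" is false (ties in ε^0 persist) and is read as non-increasing; strictness on I(X^{k+1}) is shown only if ε^k is strictly descending on I(X^k)∪I(X^{k+1}). Thresholds τ_1, τ_3, undefined when r^+=0 or r=0, are read as +∞. *)

theory Defs
  imports "HOL-Analysis.Analysis"
begin

text \<open>
  Matrices are of type \<^typ>\<open>real^'n^'m\<close>, with \<open>m = CARD('m)\<close> rows and \<open>n = CARD('n)\<close> columns;
  \<^const>\<open>norm\<close> and \<^const>\<open>inner\<close> on this type are the Frobenius norm and the trace inner product.
  Singular values and perturbations are indexed by the natural numbers \<open>1, \<dots>, m\<close>.
\<close>

text \<open>
  The singular value decomposition \<open>X = U diag(s) V\<^sup>T\<close> for \<open>m \<le> n\<close>: the vectors \<open>u 1, \<dots>, u m\<close> are the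
  columns of \<open>U\<close> and \<open>v 1, \<dots>, v m\<close> the first \<open>m\<close> columns of \<open>V\<close>. Entries of \<open>s\<close> outside
  \<open>{1..m}\<close> are set to \<open>0\<close> to make \<open>s\<close> unique.
\<close>

definition is_singular_values :: "real^'n^'m \<Rightarrow> (nat \<Rightarrow> real) \<Rightarrow> bool" where
  "is_singular_values X s \<longleftrightarrow>
     antimono_on {1..CARD('m)} s \<and>
     (\<forall>i\<in>{1..CARD('m)}. 0 \<le> s i) \<and>
     (\<forall>i. i \<notin> {1..CARD('m)} \<longrightarrow> s i = 0) \<and>
     (\<exists>(u :: nat \<Rightarrow> real^'m) (v :: nat \<Rightarrow> real^'n).
        (\<forall>i\<in>{1..CARD('m)}. \<forall>j\<in>{1..CARD('m)}. u i \<bullet> u j = (if i = j then 1 else 0)) \<and>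
        (\<forall>i\<in>{1..CARD('m)}. \<forall>j\<in>{1..CARD('m)}. v i \<bullet> v j = (if i = j then 1 else 0)) \<and>
        X = (\<chi> a b. \<Sum>i=1..CARD('m). u i $ a * s i * v i $ b))"

definition sing_val :: "nat \<Rightarrow> real^'n^'m \<Rightarrow> real" where
  "sing_val i X = (THE s. is_singular_values X s) i"

definition pos_idx :: "real^'n^'m \<Rightarrow> nat set" where
  "pos_idx X = {i \<in> {1..CARD('m)}. sing_val i X > 0}"

definition zero_idx :: "real^'n^'m \<Rightarrow> nat set" where
  "zero_idx X = {i \<in> {1..CARD('m)}. sing_val i X = 0}"

definition objective :: "(real^'n^'m \<Rightarrow> real) \<Rightarrow> real \<Rightarrow> real \<Rightarrow> real^'n^'m \<Rightarrow> real" where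
  "objective f lam p X = f X + lam * (\<Sum>i=1..CARD('m). sing_val i X powr p)"

definition C2_with_gradient :: "('a::real_inner \<Rightarrow> real) \<Rightarrow> ('a \<Rightarrow> 'a) \<Rightarrow> bool" where
  "C2_with_gradient f g \<longleftrightarrow>
     (\<forall>x. GDERIV f x :> g x) \<and>
     (\<exists>H :: 'a \<Rightarrow> 'a \<Rightarrow>\<^sub>L 'a.
        (\<forall>x. (g has_derivative blinfun_apply (H x)) (at x)) \<and> continuous_on UNIV H)"

definition weight :: "real \<Rightarrow> real^'n^'m \<Rightarrow> (nat \<Rightarrow> real) \<Rightarrow> nat \<Rightarrow> real" where
  "weight p X e i = p * (sing_val i X + e i) powr (p - 1)"

definition subproblem ::
  "(real^'n^'m \<Rightarrow> real) \<Rightarrow> (real^'n^'m \<Rightarrow> real^'n^'m) \<Rightarrow> real \<Rightarrow> real \<Rightarrow> (nat \<Rightarrow> real) \<Rightarrow>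
   real^'n^'m \<Rightarrow> real^'n^'m \<Rightarrow> real^'n^'m \<Rightarrow> real" where
  "subproblem f g lam \<beta> w Y Xk Z =
     f Y + Z \<bullet> g Y + \<beta> / 2 * (norm (Z - Y))\<^sup>2 + \<beta> / 2 * (norm (Z - Xk))\<^sup>2
     + lam * (\<Sum>i=1..CARD('m). w i * sing_val i Z)"

text \<open>
  The rule for an index \<open>i\<close> in \<open>pos_idx X - pos_idx X'\<close> or in \<open>zero_idx X'\<close>. The threshold
  \<open>\<tau>\<^sub>1 = \<sigma>\<^bsub>r'\<^esub>(X') + e'\<^bsub>r'\<^esub>\<close> has no meaning if \<open>r' = 0\<close>, that is if \<open>X' = 0\<close>; there is then no
  positive singular value to stay below and the perturbation is kept (\<open>\<tau>\<^sub>1 = \<infinity>\<close>).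
\<close>

definition clip :: "real \<Rightarrow> real^'n^'m \<Rightarrow> (nat \<Rightarrow> real) \<Rightarrow> (nat \<Rightarrow> real) \<Rightarrow> nat \<Rightarrow> real" where
  "clip \<mu> X' e e' i =
     (let r' = card (pos_idx X'); \<tau>\<^sub>1 = sing_val r' X' + e' r'; \<tau>\<^sub>2 = e (r' + 1)
      in if r' = 0 \<or> \<tau>\<^sub>1 \<ge> \<tau>\<^sub>2 then e i else min (e i) (\<mu> * \<tau>\<^sub>1))"

text \<open>
  \<open>X\<close>, \<open>e\<close> are the old and \<open>X'\<close>, \<open>e'\<close> the new iterate and perturbation. In the second case
  \<open>\<tau>\<^sub>3 = e r\<close> has no meaning if \<open>r = 0\<close>; as above it is then read as \<open>\<infinity>\<close>.
\<close>

definition eps_update ::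
  "real \<Rightarrow> real^'n^'m \<Rightarrow> real^'n^'m \<Rightarrow> (nat \<Rightarrow> real) \<Rightarrow> (nat \<Rightarrow> real) \<Rightarrow> bool" where
  "eps_update \<mu> X X' e e' \<longleftrightarrow>
     (let r = card (pos_idx X) in
       (pos_idx X' \<subset> pos_idx X \<longrightarrow>
          (\<forall>i\<in>pos_idx X'. e' i = \<mu> * e i) \<and>
          (\<forall>i\<in>pos_idx X - pos_idx X'. e' i = clip \<mu> X' e e' i) \<and>
          (\<forall>i\<in>zero_idx X. e' i = min (e i) (e' r))) \<and>
       (pos_idx X \<subset> pos_idx X' \<longrightarrow>
          (\<forall>i\<in>pos_idx X. e' i = \<mu> * e i) \<and>
          (\<forall>i\<in>pos_idx X' - pos_idx X. e' i = \<mu> * (if r = 0 then e i else min (e i) (e r))) \<and>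
          (\<forall>i\<in>zero_idx X'. e' i = clip \<mu> X' e e' i)) \<and>
       (pos_idx X = pos_idx X' \<longrightarrow>
          (\<forall>i\<in>pos_idx X'. e' i = \<mu> * e i) \<and>
          (\<forall>i\<in>zero_idx X'. e' i = clip \<mu> X' e e' i)))"

text \<open>
  The starting convention \<open>X\<^sup>-\<^sup>1 = X\<^sup>0\<close> is expressed by truncated subtraction: \<open>X (k - 1)\<close> is
  \<open>X 0\<close> for \<open>k = 0\<close>.
\<close>

definition extrapolated :: "(nat \<Rightarrow> real) \<Rightarrow> (nat \<Rightarrow> real^'n^'m) \<Rightarrow> nat \<Rightarrow> real^'n^'m" where
  "extrapolated \<alpha> X k = X k + \<alpha> k *\<^sub>R (X k - X (k - 1))"

text \<open>
  \<open>\<epsilon> 0\<close> is positive and non-increasing; ties are allowed. On indices that stay positive the update is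
  scaling by \<open>\<mu>\<close>, so ties in \<open>\<epsilon> k\<close> persist there, and the minima in the update can create new ones.
\<close>

definition EIRNRI ::
  "(real^'n^'m \<Rightarrow> real) \<Rightarrow> (real^'n^'m \<Rightarrow> real^'n^'m) \<Rightarrow> real \<Rightarrow> real \<Rightarrow> real \<Rightarrow> real \<Rightarrow> real \<Rightarrow>
   (nat \<Rightarrow> real) \<Rightarrow> (nat \<Rightarrow> real^'n^'m) \<Rightarrow> (nat \<Rightarrow> nat \<Rightarrow> real) \<Rightarrow> bool" where
  "EIRNRI f g lam p \<beta> \<mu> \<alpha>bar \<alpha> X \<epsilon> \<longleftrightarrow>
     (\<forall>i\<in>{1..CARD('m)}. 0 < \<epsilon> 0 i) \<and> antimono_on {1..CARD('m)} (\<epsilon> 0) \<and>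
     (\<forall>k. \<alpha> k \<in> {0..\<alpha>bar} \<and>
          (\<forall>Z. subproblem f g lam \<beta> (weight p (X k) (\<epsilon> k)) (extrapolated \<alpha> X k) (X k) (X (Suc k))
             \<le> subproblem f g lam \<beta> (weight p (X k) (\<epsilon> k)) (extrapolated \<alpha> X k) (X k) Z) \<and>
          eps_update \<mu> (X k) (X (Suc k)) (\<epsilon> k) (\<epsilon> (Suc k)))"

end

theory Submission
  imports Defs
begin

text \<open>
  The ordering claims hold for every single update. Singular values are sorted, so the sets of
  positive and of zero singular values are an initial and a final segment of \<open>{1..m}\<close>. On each of them
  the update is monotone in the old perturbation, and across the border the clipping rule keeps the
  perturbed singular values sorted (\<open>eps_update_ordered\<close>). The weights are a decreasing function of the
  perturbed singular values, which gives their order.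

  The asymptotic claims rest on a gap \<open>\<delta> > 0\<close> that does not depend on \<open>k\<close>: if the \<open>i\<close>-th singular value of
  \<open>X (k + 1)\<close> is positive, then the perturbed singular value \<open>sing_val i (X k) + \<epsilon> k i\<close> is at least \<open>\<delta>\<close>
  (\<open>perturbed_sing_val_gap\<close>). To see this, lower the last positive singular value of the minimiser
  \<open>X (k + 1)\<close> along its pair of singular vectors. Optimality bounds its weight by the gradient of the
  smooth part of the subproblem (\<open>weight_le_at_last_positive\<close>), which is uniformly bounded because the
  iterates are. Boundedness of the iterates follows from the level-boundedness of the objective, since
  the perturbed objective plus \<open>\<beta> / 2\<close> times the squared length of the last step never increases
  (\<open>potential_decseq\<close>). For this it suffices to compare \<open>X (k + 1)\<close> with \<open>X k\<close> in the subproblem and to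
  use that the penalty is concave with slopes \<open>w k i\<close>.

  A perturbation never grows, and it drops at least by the factor \<open>\<mu>\<close> whenever its singular value
  becomes or stays positive. So if an index is positive infinitely often, its perturbation tends to \<open>0\<close>; once it
  is below \<open>\<delta>\<close>, a vanishing singular value can never become positive again. Hence the support
  stabilises (\<open>support_stabilises\<close>). From then on the perturbations on the support are scaled by \<open>\<mu>\<close> in
  every step. A reduction off the support requires the perturbation behind the last positive singular
  value to exceed \<open>\<delta>\<close> and leaves less than \<open>\<mu>\<close> times its value, so it happens only finitely often
  (\<open>zero_eps_eventually_kept\<close>).

  Comparing subproblem values requires singular values to be well defined. Existence of the
  decomposition is proved by successive maximisation of the bilinear form, uniqueness of the values
  by a dimension count in the style of Courant and Fischer.
\<close>

section \<open>Orthonormal families\<close>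

definition orthonormal_on :: "nat set \<Rightarrow> (nat \<Rightarrow> 'a::real_inner) \<Rightarrow> bool" where
  "orthonormal_on I u \<longleftrightarrow> (\<forall>i\<in>I. \<forall>j\<in>I. u i \<bullet> u j = (if i = j then 1 else 0))"

lemma orthonormal_on_norm: "orthonormal_on I u \<Longrightarrow> i \<in> I \<Longrightarrow> norm (u i) = 1"
  by (simp add: orthonormal_on_def norm_eq_1)

lemma orthonormal_on_inj: "orthonormal_on I u \<Longrightarrow> inj_on u I"
  unfolding orthonormal_on_def inj_on_def by (metis zero_neq_one)

lemma orthonormal_on_independent:
  assumes "orthonormal_on I u"
  shows "independent (u ` I)"
proof (rule pairwise_orthogonal_independent)
  show "pairwise orthogonal (u ` I)"
    using assms by (auto simp: pairwise_def orthogonal_def orthonormal_on_def)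
  show "0 \<notin> u ` I"
    using orthonormal_on_norm[OF assms] by fastforce
qed

lemma inner_sum_orthonormal:
  assumes "orthonormal_on I u" "finite I" "j \<in> I"
  shows "(\<Sum>i\<in>I. c i *\<^sub>R u i) \<bullet> u j = c j"
proof -
  have "(\<Sum>i\<in>I. c i *\<^sub>R u i) \<bullet> u j = (\<Sum>i\<in>I. if i = j then c i else 0)"
    unfolding inner_sum_left using assms by (intro sum.cong) (auto simp: orthonormal_on_def)
  then show ?thesis using assms by simp
qed

lemma norm_sum_orthonormal:
  assumes "orthonormal_on I u" "finite I"
  shows "(norm (\<Sum>i\<in>I. c i *\<^sub>R u i))\<^sup>2 = (\<Sum>i\<in>I. (c i)\<^sup>2)"
proof -
  have "(norm (\<Sum>i\<in>I. c i *\<^sub>R u i))\<^sup>2 = (\<Sum>j\<in>I. c j * ((\<Sum>i\<in>I. c i *\<^sub>R u i) \<bullet> u j))"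
    unfolding power2_norm_eq_inner by (subst inner_sum_right) simp
  also have "\<dots> = (\<Sum>j\<in>I. (c j)\<^sup>2)"
    using inner_sum_orthonormal[OF assms] by (intro sum.cong) (auto simp: power2_eq_square)
  finally show ?thesis .
qed

lemma orthonormal_extend:
  fixes u :: "nat \<Rightarrow> 'a::euclidean_space"
  assumes "k < DIM('a)"
  obtains x where "norm x = 1" "\<forall>i\<in>{1..k}. u i \<bullet> x = 0"
proof -
  have "dim (u ` {1..k}) \<le> card (u ` {1..k})" by (rule dim_le_card') simp
  also have "\<dots> \<le> k" using card_image_le[of "{1..k}" u] by simp
  finally have "dim (u ` {1..k}) < DIM('a)" using assms by simp
  then obtain x where x: "x \<noteq> 0" "\<And>y. y \<in> span (u ` {1..k}) \<Longrightarrow> orthogonal x y"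
    using orthogonal_to_subspace_exists by blast
  show ?thesis
  proof (rule that[of "x /\<^sub>R norm x"])
    show "\<forall>i\<in>{1..k}. u i \<bullet> (x /\<^sub>R norm x) = 0"
      using x(2)[OF span_base] by (auto simp: orthogonal_def) (metis image_eqI inner_commute atLeastAtMost_iff One_nat_def)
  qed (use x in simp)
qed

text \<open>
  As many orthonormal vectors as the dimension are independent, hence span the whole space.
\<close>

lemma orthonormal_basis_expansion:
  fixes u :: "nat \<Rightarrow> 'a::euclidean_space"
  assumes "orthonormal_on {1..DIM('a)} u"
  shows "(\<Sum>i=1..DIM('a). (u i \<bullet> x) *\<^sub>R u i) = x"
proof -
  have "UNIV \<subseteq> span (u ` {1..DIM('a)})"
    using orthonormal_on_independent[OF assms] orthonormal_on_inj[OF assms]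
    by (intro card_ge_dim_independent) (auto simp: card_image)
  then have "x \<in> span (u ` {1..DIM('a)})" by auto
  moreover have "pairwise orthogonal (u ` {1..DIM('a)})"
    using assms by (auto simp: pairwise_def orthogonal_def orthonormal_on_def)
  ultimately have "(\<Sum>b\<in>u ` {1..DIM('a)}. (x \<bullet> b) *\<^sub>R b) = x"
    by (intro orthonormal_basis_expand) (auto intro: orthonormal_on_norm[OF assms])
  then show ?thesis using orthonormal_on_inj[OF assms] by (simp add: sum.reindex inner_commute)
qed

lemma norm_orthonormal_basis:
  fixes u :: "nat \<Rightarrow> 'a::euclidean_space"
  assumes "orthonormal_on {1..DIM('a)} u"
  shows "(\<Sum>i=1..DIM('a). (u i \<bullet> x)\<^sup>2) = (norm x)\<^sup>2"
  using norm_sum_orthonormal[OF assms, of "\<lambda>i. u i \<bullet> x"] orthonormal_basis_expansion[OF assms, of x]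
  by simp

section \<open>Existence of a singular value decomposition\<close>

text \<open>
  The state of a greedy construction: \<open>k\<close> singular triples have been found, and on the orthogonal
  complements of the vectors found so far the bilinear form of \<open>A\<close> is dominated by each singular
  value found so far. The last clause makes the next value automatically no larger.
\<close>

definition partial_svd ::
  "real^'n^'m \<Rightarrow> nat \<Rightarrow> (nat \<Rightarrow> real^'m) \<Rightarrow> (nat \<Rightarrow> real^'n) \<Rightarrow> (nat \<Rightarrow> real) \<Rightarrow> bool" where
  "partial_svd A k u v s \<longleftrightarrow>
     orthonormal_on {1..k} u \<and> orthonormal_on {1..k} v \<and>
     (\<forall>i\<in>{1..k}. 0 \<le> s i \<and> A *v v i = s i *\<^sub>R u i \<and> u i v* A = s i *\<^sub>R v i) \<and>
     antimono_on {1..k} s \<and>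
     (\<forall>i\<in>{1..k}. \<forall>x y. (\<forall>j\<in>{1..k}. u j \<bullet> x = 0) \<longrightarrow> (\<forall>j\<in>{1..k}. v j \<bullet> y = 0) \<longrightarrow>
        x \<bullet> (A *v y) \<le> s i * norm x * norm y)"

text \<open>
  This is the equality case of the Cauchy-Schwarz inequality: the two bounds give \<open>norm z = s\<close>, and then
  \<open>(norm (z - s *\<^sub>R u))\<^sup>2 = (norm z)\<^sup>2 - 2 * s\<^sup>2 + s\<^sup>2\<close> vanishes. It turns the maximality of a pair of unit
  vectors into the singular vector equations.
\<close>

lemma eq_scaleR_if_inner_attains_bound:
  fixes z u :: "'a::real_inner"
  assumes "norm u = 1" "z \<bullet> u = s" "z \<bullet> z \<le> s * norm z" 
  shows "z = s *\<^sub>R u"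
proof -
  have "norm z \<le> s"
    using assms(3) by (cases "z = 0") (use assms(2) in \<open>auto simp: dot_square_norm power2_eq_square\<close>)
  moreover have "s \<le> norm z" using Cauchy_Schwarz_ineq2[of z u] assms by auto
  ultimately have "norm z = s" by simp
  have "(norm (z - s *\<^sub>R u))\<^sup>2 = (norm z)\<^sup>2 - 2 * s * (z \<bullet> u) + s\<^sup>2 * (norm u)\<^sup>2"
    unfolding power2_norm_eq_inner by (simp add: algebra_simps inner_commute power2_eq_square)
  also have "\<dots> = 0" using \<open>norm z = s\<close> assms by (simp add: power2_eq_square)
  finally show ?thesis by simp
qed

text \<open>
  The next triple is a maximiser \<open>(a, b)\<close> of \<open>x \<bullet> (A *v y)\<close> over the compact set of pairs of unit
  vectors orthogonal to the earlier ones. The earlier singular vector equations show that \<open>A *v b\<close> and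
  \<open>a v* A\<close> are again orthogonal to the earlier vectors, so they can compete in the maximum, and
  this forces them to be multiples of \<open>a\<close> and \<open>b\<close>.
\<close>

lemma partial_svd_extend:
  fixes A :: "real^'n^'m"
  assumes svd: "partial_svd A k u v s" and km: "k < CARD('m)" and kn: "k < CARD('n)"
  shows "\<exists>u' v' s'. partial_svd A (Suc k) u' v' s'"
proof -
  have uo: "orthonormal_on {1..k} u" and vo: "orthonormal_on {1..k} v"
    and pairs: "\<And>i. i \<in> {1..k} \<Longrightarrow> 0 \<le> s i \<and> A *v v i = s i *\<^sub>R u i \<and> u i v* A = s i *\<^sub>R v i"
    and mono: "antimono_on {1..k} s"
    and bound: "\<And>i x y. i \<in> {1..k} \<Longrightarrow> \<forall>j\<in>{1..k}. u j \<bullet> x = 0 \<Longrightarrow> \<forall>j\<in>{1..k}. v j \<bullet> y = 0 \<Longrightarrow>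
        x \<bullet> (A *v y) \<le> s i * norm x * norm y"
    using svd unfolding partial_svd_def by blast+
  define S where "S = {x. \<forall>j\<in>{1..k}. u j \<bullet> x = 0}"
  define T where "T = {y. \<forall>j\<in>{1..k}. v j \<bullet> y = 0}"
  have "closed S" "closed T"
  proof -
    have "S = (\<Inter>j\<in>{1..k}. {x. u j \<bullet> x = 0})" "T = (\<Inter>j\<in>{1..k}. {x. v j \<bullet> x = 0})"
      by (auto simp: S_def T_def)
    then show "closed S" "closed T" by (auto intro!: closed_INT closed_hyperplane)
  qed
  then have comp: "compact ((S \<inter> sphere 0 1) \<times> (T \<inter> sphere 0 1))"
    by (intro compact_Times closed_Int_compact compact_sphere)
  obtain x0 where "norm x0 = 1" "x0 \<in> S"
    using orthonormal_extend[of k u] km by (auto simp: S_def)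
  moreover obtain y0 where "norm y0 = 1" "y0 \<in> T"
    using orthonormal_extend[of k v] kn by (auto simp: T_def)
  ultimately have ne: "(S \<inter> sphere 0 1) \<times> (T \<inter> sphere 0 1) \<noteq> {}" by auto
  have "continuous_on ((S \<inter> sphere 0 1) \<times> (T \<inter> sphere 0 1)) (\<lambda>(x, y). x \<bullet> (A *v y))"
    unfolding split_beta by (intro continuous_intros linear_continuous_on_compose[of _ snd "(*v) A"]) auto
  from continuous_attains_sup[OF comp ne this] obtain a b where
    ab: "a \<in> S" "norm a = 1" "b \<in> T" "norm b = 1" and
    max: "\<And>x y. x \<in> S \<Longrightarrow> norm x = 1 \<Longrightarrow> y \<in> T \<Longrightarrow> norm y = 1 \<Longrightarrow> x \<bullet> (A *v y) \<le> a \<bullet> (A *v b)"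
    by fastforce
  define c where "c = a \<bullet> (A *v b)"
  have le_c: "x \<bullet> (A *v y) \<le> c * norm x * norm y" if "x \<in> S" "y \<in> T" for x y
  proof (cases "x = 0 \<or> y = 0")
    case False
    then have "(x /\<^sub>R norm x) \<bullet> (A *v (y /\<^sub>R norm y)) \<le> c"
      unfolding c_def using that by (intro max) (auto simp: S_def T_def)
    then show ?thesis using False 
      by (simp add: matrix_vector_mult_scaleR field_simps)
  qed auto
  \<comment> \<open>The value at the pair \<open>(- a, b)\<close> is \<open>- c\<close>, and it is at most \<open>c\<close>.\<close>
  have c0: "0 \<le> c"
    using le_c[of "- a" b] ab unfolding c_def S_def by simp
  have "A *v b \<in> S"
  proof -
    have "u j \<bullet> (A *v b) = 0" if "j \<in> {1..k}" for j
      using pairs[OF that] ab that by (simp flip: dot_lmul_matrix add: T_def)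
    then show ?thesis by (simp add: S_def)
  qed
  then have Ab: "A *v b = c *\<^sub>R a"
    using ab le_c[of "A *v b" b]
    by (intro eq_scaleR_if_inner_attains_bound) (auto simp: c_def inner_commute)
  have "a v* A \<in> T"
  proof -
    have "v j \<bullet> (a v* A) = 0" if "j \<in> {1..k}" for j
    proof -
      have "v j \<bullet> (a v* A) = a \<bullet> (A *v v j)" by (metis dot_lmul_matrix inner_commute)
      also have "\<dots> = s j * (u j \<bullet> a)" using pairs[OF that] by (simp add: inner_commute)
      also have "\<dots> = 0" using ab(1) that by (simp add: S_def)
      finally show ?thesis .
    qed
    then show ?thesis by (simp add: T_def)
  qed
  then have aA: "a v* A = c *\<^sub>R b"
    using ab le_c[of a "a v* A"]
    by (intro eq_scaleR_if_inner_attains_bound) (auto simp: c_def dot_lmul_matrix)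
  have c_le: "c \<le> s i" if "i \<in> {1..k}" for i
    using bound[OF that, of a b] ab by (simp add: c_def S_def T_def)
  define u' v' s' where "u' = u(Suc k := a)" and "v' = v(Suc k := b)" and "s' = s(Suc k := c)"
  have old: "u' i = u i" "v' i = v i" "s' i = s i" if "i \<in> {1..k}" for i
    using that by (auto simp: u'_def v'_def s'_def)
  have new: "u' (Suc k) = a" "v' (Suc k) = b" "s' (Suc k) = c"
    by (auto simp: u'_def v'_def s'_def)
  have I: "{1..Suc k} = insert (Suc k) {1..k}" by auto
  have "orthonormal_on {1..Suc k} u'" 
    using uo ab unfolding I orthonormal_on_def S_def 
    by (auto simp: old new inner_commute dot_square_norm)
  moreover have "orthonormal_on {1..Suc k} v'" 
    using vo ab unfolding I orthonormal_on_def T_def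
    by (auto simp: old new inner_commute dot_square_norm)
  moreover have "0 \<le> s' i \<and> A *v v' i = s' i *\<^sub>R u' i \<and> u' i v* A = s' i *\<^sub>R v' i" 
    if "i \<in> {1..Suc k}" for i
    using that pairs c0 Ab aA unfolding I by (auto simp: old new)
  moreover have "antimono_on {1..Suc k} s'"
  proof (rule monotone_onI)
    fix i j assume ij: "i \<in> {1..Suc k}" "j \<in> {1..Suc k}" "i \<le> j"
    show "s' j \<le> s' i"
    proof (cases "j = Suc k")
      case True then show ?thesis using ij c_le[of i] by (cases "i = Suc k") (auto simp: old new)
    next
      case False then show ?thesis using ij mono by (simp add: old monotone_on_def)
    qed
  qed
  moreover have "x \<bullet> (A *v y) \<le> s' i * norm x * norm y"
    if i: "i \<in> {1..Suc k}" and xy: "\<forall>j\<in>{1..Suc k}. u' j \<bullet> x = 0" "\<forall>j\<in>{1..Suc k}. v' j \<bullet> y = 0" for i x y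
  proof -
    have "c \<le> s' i" using i c_le[of i] unfolding I by (auto simp: old new)
    moreover have "u j \<bullet> x = 0 \<and> v j \<bullet> y = 0" if j: "j \<in> {1..k}" for j
    proof -
      have "u' j \<bullet> x = 0 \<and> v' j \<bullet> y = 0" using xy j by auto
      then show ?thesis by (simp add: old[OF j])
    qed
    then have "x \<in> S" "y \<in> T" by (auto simp: S_def T_def)
    ultimately show ?thesis
      using le_c[of x y] mult_right_mono[of c "s' i" "norm x * norm y"] by (simp add: mult.assoc)
  qed
  ultimately show ?thesis unfolding partial_svd_def by blast
qed

lemma partial_svd_exists:
  fixes A :: "real^'n^'m"
  assumes "k \<le> CARD('m)" "CARD('m) \<le> CARD('n)"
  shows "\<exists>u v s. partial_svd A k u v s"
  using assms(1)
proof (induction k)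
  case 0
  then show ?case by (auto simp: partial_svd_def orthonormal_on_def)
next
  case (Suc k)
  then show ?case using partial_svd_extend[of A k] assms(2) by auto
qed

text \<open>
  After \<open>CARD('m)\<close> steps the left singular vectors form a basis, so the singular vector equations
  determine \<open>A\<close>; evaluating them on the standard basis vectors gives the entries of \<open>A\<close>.
\<close>

lemma svd_exists:
  fixes A :: "real^'n^'m"
  assumes "CARD('m) \<le> CARD('n)"
  shows "\<exists>s. is_singular_values A s"
proof -
  obtain u v s where svd: "partial_svd A CARD('m) u v s"
    using partial_svd_exists[OF le_refl assms] by blast
  have uo: "orthonormal_on {1..DIM(real^'m)} u" using svd by (simp add: partial_svd_def)
  have "A $ a $ b = (\<Sum>i=1..CARD('m). u i $ a * s i * v i $ b)" for a b
  proof -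
    have "A $ a $ b = axis a 1 \<bullet> (A *v axis b 1)"
      by (simp add: inner_axis' matrix_vector_mult_basis column_def)
    also have "\<dots> = (axis a 1 v* A) \<bullet> axis b 1" by (simp add: dot_lmul_matrix)
    also have "axis a 1 v* A = (\<Sum>i=1..CARD('m). (u i $ a) *\<^sub>R (u i v* A))"
    proof -
      have "(\<Sum>i=1..CARD('m). (u i $ a) *\<^sub>R u i) = axis a 1"
        using orthonormal_basis_expansion[OF uo, of "axis a 1"] by (simp add: inner_axis)
      moreover have lin: "linear (\<lambda>x. x v* A)"
        using matrix_vector_mul_linear[of "transpose A"] by simp
      ultimately have "axis a 1 v* A = (\<Sum>i=1..CARD('m). ((u i $ a) *\<^sub>R u i) v* A)"
        using linear_sum[OF lin, of "\<lambda>i. (u i $ a) *\<^sub>R u i" "{1..CARD('m)}"] by simp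
      also have "\<dots> = (\<Sum>i=1..CARD('m). (u i $ a) *\<^sub>R (u i v* A))"
        by (rule sum.cong[OF refl]) (rule linear_scale[OF lin])
      finally show ?thesis .
    qed
    also have "\<dots> \<bullet> axis b 1 = (\<Sum>i=1..CARD('m). u i $ a * s i * v i $ b)"
      using svd by (auto simp: partial_svd_def inner_sum_left inner_axis intro!: sum.cong)
    finally show ?thesis .
  qed
  then have "A = (\<chi> a b. \<Sum>i=1..CARD('m). u i $ a * s i * v i $ b)" by (simp add: vec_eq_iff)
  then have "is_singular_values A (\<lambda>i. if i \<in> {1..CARD('m)} then s i else 0)"
    using svd unfolding is_singular_values_def partial_svd_def orthonormal_on_def
    by (auto simp: monotone_on_def intro!: exI[of _ u] exI[of _ v] sum.cong)
  then show ?thesis by blast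
qed

section \<open>Uniqueness of the singular values\<close>

text \<open>
  The only information on \<open>A\<close> that uniqueness needs: its singular values diagonalise the quadratic
  form \<open>x \<mapsto> (norm (x v* A))\<^sup>2\<close> in an orthonormal basis.
\<close>

definition left_singular :: "real^'n^'m \<Rightarrow> (nat \<Rightarrow> real) \<Rightarrow> (nat \<Rightarrow> real^'m) \<Rightarrow> bool" where
  "left_singular A s u \<longleftrightarrow> orthonormal_on {1..CARD('m)} u \<and>
     (\<forall>x. (norm (x v* A))\<^sup>2 = (\<Sum>i=1..CARD('m). (s i)\<^sup>2 * (u i \<bullet> x)\<^sup>2))"

lemma is_singular_values_left_singular:
  fixes A :: "real^'n^'m"
  assumes "is_singular_values A s"
  shows "\<exists>u. left_singular A s u"
proof -
  obtain u v where uv: "orthonormal_on {1..CARD('m)} u" "orthonormal_on {1..CARD('m)} v"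
    and A: "A = (\<chi> a b. \<Sum>i=1..CARD('m). u i $ a * s i * v i $ b)"
    using assms unfolding is_singular_values_def orthonormal_on_def by blast
  have "x v* A = (\<Sum>i=1..CARD('m). (s i * (u i \<bullet> x)) *\<^sub>R v i)" for x
  proof -
    have "(x v* A) $ b = (\<Sum>i=1..CARD('m). (s i * (u i \<bullet> x)) *\<^sub>R v i) $ b" for b
    proof -
      have "(x v* A) $ b = (\<Sum>a\<in>UNIV. \<Sum>i=1..CARD('m). x $ a * (u i $ a * s i * v i $ b))"
        by (simp add: A vector_matrix_mult_def sum_distrib_left)
      also have "\<dots> = (\<Sum>i=1..CARD('m). \<Sum>a\<in>UNIV. x $ a * (u i $ a * s i * v i $ b))"
        by (rule sum.swap)
      also have "\<dots> = (\<Sum>i=1..CARD('m). (s i * (u i \<bullet> x)) *\<^sub>R v i) $ b"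
        by (simp add: inner_vec_def sum_distrib_left sum_distrib_right mult_ac)
      finally show ?thesis .
    qed
    then show ?thesis by (simp add: vec_eq_iff)
  qed
  then have "(norm (x v* A))\<^sup>2 = (\<Sum>i=1..CARD('m). (s i)\<^sup>2 * (u i \<bullet> x)\<^sup>2)" for x
    using norm_sum_orthonormal[OF uv(2)] by (simp add: power_mult_distrib)
  with uv(1) show ?thesis unfolding left_singular_def by blast
qed

text \<open>
  The argument of Courant and Fischer. Some \<open>x \<noteq> 0\<close> is orthogonal to the \<open>m - k\<close> vectors
  \<open>u (k + 1), \<dots>, u m\<close> of the first decomposition and to the \<open>k - 1\<close> vectors \<open>w 1, \<dots>, w (k - 1)\<close>
  of the second, since these are fewer than \<open>m\<close> vectors. For this \<open>x\<close> the quadratic form is at least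
  \<open>(s k)\<^sup>2 * (norm x)\<^sup>2\<close> by the first and at most \<open>(t k)\<^sup>2 * (norm x)\<^sup>2\<close> by the second decomposition.
\<close>

lemma singular_value_le:
  fixes A :: "real^'n^'m"
  assumes s: "is_singular_values A s" and t: "is_singular_values A t" and k: "k \<in> {1..CARD('m)}"
  shows "s k \<le> t k"
proof -
  obtain u where u: "left_singular A s u" using is_singular_values_left_singular[OF s] by blast
  obtain w where w: "left_singular A t w" using is_singular_values_left_singular[OF t] by blast
  define V where "V = u ` {Suc k..CARD('m)} \<union> w ` {1..<k}"
  have "dim V \<le> card V" unfolding V_def by (rule dim_le_card') simp
  also have "\<dots> \<le> card (u ` {Suc k..CARD('m)}) + card (w ` {1..<k})"
    unfolding V_def by (rule card_Un_le)
  also have "\<dots> \<le> (CARD('m) - k) + (k - 1)"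
    by (intro add_mono order.trans[OF card_image_le]) auto
  also have "\<dots> < DIM(real^'m)" using k by auto
  finally obtain x where "x \<noteq> 0" and x: "\<And>y. y \<in> span V \<Longrightarrow> orthogonal x y"
    using orthogonal_to_subspace_exists by blast
  have ux: "u i \<bullet> x = 0" if "i \<in> {Suc k..CARD('m)}" for i
    using x[OF span_base, of "u i"] that by (auto simp: V_def orthogonal_def inner_commute)
  have wx: "w i \<bullet> x = 0" if "i \<in> {1..<k}" for i
    using x[OF span_base, of "w i"] that by (auto simp: V_def orthogonal_def inner_commute)
  have "(s k)\<^sup>2 * (norm x)\<^sup>2 = (\<Sum>i=1..CARD('m). (s k)\<^sup>2 * (u i \<bullet> x)\<^sup>2)"
    using norm_orthonormal_basis[of u x] u by (simp add: left_singular_def flip: sum_distrib_left)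
  also have "\<dots> \<le> (\<Sum>i=1..CARD('m). (s i)\<^sup>2 * (u i \<bullet> x)\<^sup>2)"
  proof (rule sum_mono)
    fix i assume i: "i \<in> {1..CARD('m)}"
    show "(s k)\<^sup>2 * (u i \<bullet> x)\<^sup>2 \<le> (s i)\<^sup>2 * (u i \<bullet> x)\<^sup>2"
    proof (cases "i \<le> k")
      case True
      then have "s k \<le> s i" "0 \<le> s k"
        using s i k by (auto simp: is_singular_values_def monotone_on_def)
      then show ?thesis by (intro mult_right_mono power_mono) auto
    qed (use ux i in auto)
  qed
  also have "\<dots> = (\<Sum>i=1..CARD('m). (t i)\<^sup>2 * (w i \<bullet> x)\<^sup>2)"
  proof -
    have "(norm (x v* A))\<^sup>2 = (\<Sum>i=1..CARD('m). (s i)\<^sup>2 * (u i \<bullet> x)\<^sup>2)"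
      using u by (simp add: left_singular_def)
    moreover have "(norm (x v* A))\<^sup>2 = (\<Sum>i=1..CARD('m). (t i)\<^sup>2 * (w i \<bullet> x)\<^sup>2)"
      using w by (simp add: left_singular_def)
    ultimately show ?thesis by simp
  qed
  also have "\<dots> \<le> (\<Sum>i=1..CARD('m). (t k)\<^sup>2 * (w i \<bullet> x)\<^sup>2)"
  proof (rule sum_mono)
    fix i assume i: "i \<in> {1..CARD('m)}"
    show "(t i)\<^sup>2 * (w i \<bullet> x)\<^sup>2 \<le> (t k)\<^sup>2 * (w i \<bullet> x)\<^sup>2"
    proof (cases "k \<le> i")
      case True
      then have "t i \<le> t k" "0 \<le> t i"
        using t i k by (auto simp: is_singular_values_def monotone_on_def)
      then show ?thesis by (intro mult_right_mono power_mono) auto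
    qed (use wx i in auto)
  qed
  also have "\<dots> = (t k)\<^sup>2 * (norm x)\<^sup>2"
    using norm_orthonormal_basis[of w x] w by (simp add: left_singular_def flip: sum_distrib_left)
  finally have "(s k)\<^sup>2 \<le> (t k)\<^sup>2" using \<open>x \<noteq> 0\<close> by simp
  then show ?thesis using t k by (auto simp: is_singular_values_def intro: power2_le_imp_le)
qed

lemma singular_values_unique:
  fixes A :: "real^'n^'m"
  assumes s: "is_singular_values A s" and t: "is_singular_values A t"
  shows "s = t"
proof
  fix k show "s k = t k"
  proof (cases "k \<in> {1..CARD('m)}")
    case True
    then show ?thesis using singular_value_le[OF s t] singular_value_le[OF t s] by force
  next
    case False
    then show ?thesis using s t by (auto simp: is_singular_values_def)
  qed
qed

lemma sing_val_eq: "is_singular_values A s \<Longrightarrow> sing_val i A = s i"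
  unfolding sing_val_def using singular_values_unique by (subst the_equality) blast+

lemma is_singular_values_sing_val:
  fixes A :: "real^'n^'m"
  assumes "CARD('m) \<le> CARD('n)"
  shows "is_singular_values A (\<lambda>i. sing_val i A)"
proof -
  obtain s where "is_singular_values A s" using svd_exists[OF assms] by blast
  moreover from this have "(\<lambda>i. sing_val i A) = s" using sing_val_eq by blast
  ultimately show ?thesis by simp
qed

lemma sing_val_nonneg:
  fixes A :: "real^'n^'m"
  assumes "CARD('m) \<le> CARD('n)"
  shows "0 \<le> sing_val i A"
  using is_singular_values_sing_val[OF assms, of A]
  by (cases "i \<in> {1..CARD('m)}") (auto simp: is_singular_values_def)

lemma sing_val_antimono:
  fixes A :: "real^'n^'m"
  assumes "CARD('m) \<le> CARD('n)"
  shows "antimono_on {1..CARD('m)} (\<lambda>i. sing_val i A)"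
  using is_singular_values_sing_val[OF assms, of A] by (simp add: is_singular_values_def)

text \<open>
  With \<open>D = u r (v r)\<^sup>T\<close> taken from a decomposition of \<open>A\<close>, the matrix \<open>A - t *\<^sub>R D\<close> has the same
  singular vectors, and the values are still in non-increasing order because everything after
  position \<open>r\<close> is zero. This is the comparison matrix for the optimality condition of the subproblem.
\<close>

lemma sing_val_lower_last_positive:
  fixes A :: "real^'n^'m"
  assumes mn: "CARD('m) \<le> CARD('n)" and r: "r \<in> {1..CARD('m)}" 
    and zero: "\<And>i. i \<in> {r<..CARD('m)} \<Longrightarrow> sing_val i A = 0"
  obtains D :: "real^'n^'m" where "norm D = 1" 
    "\<And>t i. 0 \<le> t \<Longrightarrow> t \<le> sing_val r A \<Longrightarrow> 
       sing_val i (A - t *\<^sub>R D) = (if i = r then sing_val r A - t else sing_val i A)"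
proof -
  let ?s = "\<lambda>i. sing_val i A"
  have s: "is_singular_values A ?s" by (rule is_singular_values_sing_val[OF mn])
  then obtain u v where u: "\<forall>i\<in>{1..CARD('m)}. \<forall>j\<in>{1..CARD('m)}. u i \<bullet> u j = (if i = j then 1 else 0)" 
    and v: "\<forall>i\<in>{1..CARD('m)}. \<forall>j\<in>{1..CARD('m)}. v i \<bullet> v j = (if i = j then 1 else 0)" 
    and A: "A = (\<chi> a b. \<Sum>i=1..CARD('m). u i $ a * ?s i * v i $ b)"
    unfolding is_singular_values_def by blast
  define D :: "real^'n^'m" where "D = (\<chi> a b. u r $ a * v r $ b)"
  show ?thesis
  proof (rule that)
    have "D \<bullet> D = (u r \<bullet> u r) * (v r \<bullet> v r)"
      by (simp add: D_def inner_vec_def sum_product mult_ac)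
    then show "norm D = 1" using u v r by (simp add: norm_eq_1)
    fix t :: real and i assume t: "0 \<le> t" "t \<le> ?s r"
    let ?s' = "\<lambda>i. if i = r then ?s r - t else ?s i"
    have "antimono_on {1..CARD('m)} ?s'"
    proof (rule monotone_onI)
      fix i j assume ij: "i \<in> {1..CARD('m)}" "j \<in> {1..CARD('m)}" "i \<le> j"
      then have "?s j \<le> ?s i" using s by (auto simp: is_singular_values_def monotone_on_def)
      then show "?s' j \<le> ?s' i" using t zero[of j] ij by auto
    qed
    moreover have "A - t *\<^sub>R D = (\<chi> a b. \<Sum>i=1..CARD('m). u i $ a * ?s' i * v i $ b)"
    proof -
      have "(A - t *\<^sub>R D) $ a $ b = (\<Sum>i=1..CARD('m). u i $ a * ?s' i * v i $ b)" for a b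
      proof -
        have "(\<Sum>i=1..CARD('m). u i $ a * ?s' i * v i $ b) 
            = (\<Sum>i=1..CARD('m). u i $ a * ?s i * v i $ b - (if i = r then t * (u r $ a * v r $ b) else 0))"
          by (intro sum.cong) (auto simp: algebra_simps)
        also have "\<dots> = A $ a $ b - t * (u r $ a * v r $ b)"
          using r by (subst A) (simp add: sum_subtractf)
        finally show ?thesis by (simp add: D_def)
      qed
      then show ?thesis by (simp add: vec_eq_iff)
    qed
    moreover have "\<forall>i\<in>{1..CARD('m)}. 0 \<le> ?s' i" "\<forall>i. i \<notin> {1..CARD('m)} \<longrightarrow> ?s' i = 0"
      using s t r by (auto simp: is_singular_values_def)
    ultimately have "is_singular_values (A - t *\<^sub>R D) ?s'"
      using u v unfolding is_singular_values_def by blast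
    then show "sing_val i (A - t *\<^sub>R D) = ?s' i" by (rule sing_val_eq)
  qed
qed

section \<open>One update of the perturbations\<close>

text \<open>
  Singular values are sorted, so an index set \<open>pos_idx A\<close> is an initial segment of \<open>{1..m}\<close> and is
  determined by its length. The inclusions that distinguish the cases of the update become
  comparisons of two numbers.
\<close>

abbreviation pos_count :: "real^'n^'m \<Rightarrow> nat" where
  "pos_count A \<equiv> card (pos_idx A)"

lemma pos_idx_eq:
  fixes A :: "real^'n^'m"
  assumes "CARD('m) \<le> CARD('n)"
  shows "pos_idx A = {1..pos_count A}"
proof (cases "pos_idx A = {}")
  case False
  have fin: "finite (pos_idx A)" by (simp add: pos_idx_def)
  have "pos_idx A = {1..Max (pos_idx A)}"
  proof
    show "pos_idx A \<subseteq> {1..Max (pos_idx A)}"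
      using fin by (auto simp: pos_idx_def)
    have M: "Max (pos_idx A) \<in> pos_idx A" using fin False by simp
    show "{1..Max (pos_idx A)} \<subseteq> pos_idx A"
    proof
      fix i assume i: "i \<in> {1..Max (pos_idx A)}"
      then have "sing_val (Max (pos_idx A)) A \<le> sing_val i A"
        using sing_val_antimono[OF assms, of A] M by (auto simp: monotone_on_def pos_idx_def)
      then show "i \<in> pos_idx A" using i M by (auto simp: pos_idx_def)
    qed
  qed
  then show ?thesis by (metis card_atLeastAtMost diff_Suc_1)
qed simp

lemma pos_count_le: "pos_count (A :: real^'n^'m) \<le> CARD('m)"
proof -
  have "pos_count A \<le> card {1..CARD('m)}" by (intro card_mono) (auto simp: pos_idx_def)
  then show ?thesis by simp
qed

lemma mem_pos_idx_iff:
  fixes A :: "real^'n^'m"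
  assumes "CARD('m) \<le> CARD('n)"
  shows "i \<in> pos_idx A \<longleftrightarrow> 1 \<le> i \<and> i \<le> pos_count A"
  by (subst pos_idx_eq[OF assms]) simp

lemma sing_val_pos_iff:
  fixes A :: "real^'n^'m"
  assumes "CARD('m) \<le> CARD('n)" "i \<in> {1..CARD('m)}"
  shows "0 < sing_val i A \<longleftrightarrow> i \<le> pos_count A"
proof -
  have "0 < sing_val i A \<longleftrightarrow> i \<in> pos_idx A" using assms(2) by (simp add: pos_idx_def)
  also have "\<dots> \<longleftrightarrow> i \<le> pos_count A" using assms(2) by (simp add: mem_pos_idx_iff[OF assms(1)])
  finally show ?thesis .
qed

lemma zero_idx_eq:
  fixes A :: "real^'n^'m"
  assumes "CARD('m) \<le> CARD('n)"
  shows "zero_idx A = {pos_count A<..CARD('m)}"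
proof -
  have "i \<in> zero_idx A \<longleftrightarrow> i \<in> {1..CARD('m)} \<and> \<not> 0 < sing_val i A" for i
    using sing_val_nonneg[OF assms, of i A] by (auto simp: zero_idx_def)
  then show ?thesis using sing_val_pos_iff[OF assms, of _ A] by (auto simp: Suc_le_eq)
qed

lemma sing_val_zero:
  fixes A :: "real^'n^'m"
  assumes "CARD('m) \<le> CARD('n)" "i \<in> {pos_count A<..CARD('m)}"
  shows "sing_val i A = 0"
proof -
  have "i \<in> zero_idx A" using assms(2) by (subst zero_idx_eq[OF assms(1)])
  then show ?thesis by (simp add: zero_idx_def)
qed

text \<open>
  The update read for a single index \<open>i\<close>, according to the position of \<open>i\<close> relative to the old and
  the new number of positive singular values.
\<close>

lemma eps_update_cases:
  fixes A A' :: "real^'n^'m"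
  assumes mn: "CARD('m) \<le> CARD('n)" and upd: "eps_update \<mu> A A' e e'"
    and i: "i \<in> {1..CARD('m)}"
  shows "i \<le> pos_count A \<Longrightarrow> i \<le> pos_count A' \<Longrightarrow> e' i = \<mu> * e i"
    and "i \<le> pos_count A \<Longrightarrow> pos_count A' < i \<Longrightarrow> e' i = clip \<mu> A' e e' i"
    and "pos_count A < i \<Longrightarrow> i \<le> pos_count A' \<Longrightarrow>
      e' i = \<mu> * (if pos_count A = 0 then e i else min (e i) (e (pos_count A)))"
    and "pos_count A \<le> pos_count A' \<Longrightarrow> pos_count A' < i \<Longrightarrow> e' i = clip \<mu> A' e e' i"
    and "pos_count A' < pos_count A \<Longrightarrow> pos_count A < i \<Longrightarrow> e' i = min (e i) (e' (pos_count A))"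
proof -
  define r r' where "r = pos_count A" and "r' = pos_count A'"
  have P: "pos_idx A = {1..r}" "pos_idx A' = {1..r'}" "zero_idx A = {r<..CARD('m)}" 
    "zero_idx A' = {r'<..CARD('m)}"
    unfolding r_def r'_def by (rule pos_idx_eq[OF mn] zero_idx_eq[OF mn])+
  have c: "{1..a} \<subset> {1..b} \<longleftrightarrow> a < b" "{1..a} = {1..b} \<longleftrightarrow> a = b" for a b :: nat
    by (auto simp: psubset_eq)
  note u = upd[unfolded eps_update_def P c Let_def card_atLeastAtMost diff_Suc_1]
  have down: "r' < r \<Longrightarrow> (\<forall>i\<in>{1..r'}. e' i = \<mu> * e i) \<and>
      (\<forall>i\<in>{1..r} - {1..r'}. e' i = clip \<mu> A' e e' i) \<and> (\<forall>i\<in>{r<..CARD('m)}. e' i = min (e i) (e' r))"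
    and up: "r < r' \<Longrightarrow> (\<forall>i\<in>{1..r}. e' i = \<mu> * e i) \<and>
      (\<forall>i\<in>{1..r'} - {1..r}. e' i = \<mu> * (if r = 0 then e i else min (e i) (e r))) \<and>
      (\<forall>i\<in>{r'<..CARD('m)}. e' i = clip \<mu> A' e e' i)"
    and same: "r = r' \<Longrightarrow> (\<forall>i\<in>{1..r'}. e' i = \<mu> * e i) \<and> (\<forall>i\<in>{r'<..CARD('m)}. e' i = clip \<mu> A' e e' i)"
    using u by blast+
  have "i \<le> r \<Longrightarrow> i \<le> r' \<Longrightarrow> e' i = \<mu> * e i"
    using i down up same by (cases r r' rule: linorder_cases) auto
  moreover have "i \<le> r \<Longrightarrow> r' < i \<Longrightarrow> e' i = clip \<mu> A' e e' i"
    using i down by auto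
  moreover have "r < i \<Longrightarrow> i \<le> r' \<Longrightarrow> e' i = \<mu> * (if r = 0 then e i else min (e i) (e r))"
    using i up by auto
  moreover have "r \<le> r' \<Longrightarrow> r' < i \<Longrightarrow> e' i = clip \<mu> A' e e' i"
    using i up same by (cases r r' rule: linorder_cases) auto
  moreover have "r' < r \<Longrightarrow> r < i \<Longrightarrow> e' i = min (e i) (e' r)"
    using i down by auto
  ultimately show "i \<le> pos_count A \<Longrightarrow> i \<le> pos_count A' \<Longrightarrow> e' i = \<mu> * e i"
    and "i \<le> pos_count A \<Longrightarrow> pos_count A' < i \<Longrightarrow> e' i = clip \<mu> A' e e' i"
    and "pos_count A < i \<Longrightarrow> i \<le> pos_count A' \<Longrightarrow>
      e' i = \<mu> * (if pos_count A = 0 then e i else min (e i) (e (pos_count A)))"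
    and "pos_count A \<le> pos_count A' \<Longrightarrow> pos_count A' < i \<Longrightarrow> e' i = clip \<mu> A' e e' i"
    and "pos_count A' < pos_count A \<Longrightarrow> pos_count A < i \<Longrightarrow> e' i = min (e i) (e' (pos_count A))"
    unfolding r_def r'_def by blast+
qed

text \<open>
  The invariant of the algorithm. The monotonicity of the perturbed singular values does not follow
  from the other clauses: at the border between \<open>pos_idx A\<close> and \<open>zero_idx A\<close> the sequence \<open>e\<close> itself
  may increase.
\<close>

definition ordered_eps :: "real^'n^'m \<Rightarrow> (nat \<Rightarrow> real) \<Rightarrow> bool" where
  "ordered_eps A e \<longleftrightarrow>
     (\<forall>i\<in>{1..CARD('m)}. 0 < e i) \<and> antimono_on (pos_idx A) e \<and> antimono_on (zero_idx A) e \<and>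
     antimono_on {1..CARD('m)} (\<lambda>i. sing_val i A + e i)"

lemma antimono_on_atLeastAtMost_joinI:
  fixes h :: "nat \<Rightarrow> real"
  assumes "antimono_on {1..a} h" "antimono_on {a<..b} h" "1 \<le> a \<Longrightarrow> Suc a \<le> b \<Longrightarrow> h (Suc a) \<le> h a"
  shows "antimono_on {1..b} h"
proof (rule monotone_onI)
  fix i j assume ij: "i \<in> {1..b}" "j \<in> {1..b}" "i \<le> j"
  show "h j \<le> h i"
  proof (cases "a < i \<or> j \<le> a")
    case True
    then show ?thesis using assms(1,2) ij by (auto simp: monotone_on_def)
  next
    case False
    then have "h j \<le> h (Suc a)" "h a \<le> h i"
      using assms(1,2) ij by (auto simp: monotone_on_def)
    then show ?thesis using assms(3) False ij by simp
  qed
qed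

lemma clip_le: "clip \<mu> A' e e' i \<le> e i"
  by (simp add: clip_def Let_def)

lemma clip_pos:
  fixes A' :: "real^'n^'m"
  assumes "CARD('m) \<le> CARD('n)" "0 < \<mu>" "0 < e i" "\<forall>j\<in>pos_idx A'. 0 < e' j"
  shows "0 < clip \<mu> A' e e' i"
proof (cases "pos_count A' = 0")
  case False
  then have "pos_count A' \<in> pos_idx A'" using mem_pos_idx_iff[OF assms(1)] by auto
  then have "0 < sing_val (pos_count A') A' + e' (pos_count A')"
    using assms(4) by (intro add_pos_pos) (auto simp: pos_idx_def)
  then show ?thesis using assms(2,3) by (simp add: clip_def Let_def)
qed (use assms in \<open>simp add: clip_def\<close>)

lemma clip_mono: "e j \<le> e i \<Longrightarrow> clip \<mu> A' e e' j \<le> clip \<mu> A' e e' i"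
  by (auto simp: clip_def Let_def)

text \<open>
  This is what clipping is for: the first perturbation behind the positive singular values does not
  exceed the last positive perturbed singular value.
\<close>

lemma clip_Suc_pos_count_le:
  assumes "0 < \<mu>" "\<mu> < 1" "pos_count A' \<noteq> 0"
    "0 \<le> sing_val (pos_count A') A' + e' (pos_count A')"
  shows "clip \<mu> A' e e' (Suc (pos_count A')) \<le> sing_val (pos_count A') A' + e' (pos_count A')"
proof -
  have "\<mu> * (sing_val (pos_count A') A' + e' (pos_count A')) 
      \<le> sing_val (pos_count A') A' + e' (pos_count A')"
    using assms by (intro mult_left_le_one_le) auto
  then show ?thesis using assms(3) by (auto simp: clip_def Let_def)
qed

context
  fixes A A' :: "real^'n^'m" and e e' :: "nat \<Rightarrow> real" and \<mu> :: real
  assumes mn: "CARD('m) \<le> CARD('n)" and \<mu>: "0 < \<mu>" "\<mu> < 1"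
    and upd: "eps_update \<mu> A A' e e'"
begin

lemma eps_update_pos:
  assumes ord: "ordered_eps A e" and i: "i \<in> {1..CARD('m)}"
  shows "0 < e' i"
proof -
  have e: "0 < e j" if "j \<in> {1..CARD('m)}" for j using ord that by (simp add: ordered_eps_def)
  note u = eps_update_cases[OF mn upd]
  have pos: "0 < e' j" if "j \<in> pos_idx A'" for j
  proof -
    have j: "j \<in> {1..CARD('m)}" "j \<le> pos_count A'"
      using that pos_count_le[of A'] by (auto simp: mem_pos_idx_iff[OF mn])
    have "0 < e (pos_count A)" if "pos_count A \<noteq> 0"
      using e[of "pos_count A"] that pos_count_le[of A] by simp
    then show ?thesis using u(1,3)[OF j(1)] j(2) e[OF j(1)] \<mu>
      by (cases "j \<le> pos_count A") auto
  qed
  have clip: "0 < clip \<mu> A' e e' j" if "j \<in> {1..CARD('m)}" for j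
    using clip_pos[of \<mu> e j A' e', OF mn \<mu>(1) e[OF that]] pos by blast
  have r: "0 < e' (pos_count A)" if "pos_count A' < pos_count A"
    using u(2)[of "pos_count A"] clip[of "pos_count A"] that pos_count_le[of A] by simp
  show ?thesis
  proof (cases "i \<le> pos_count A'")
    case True
    then show ?thesis using pos i by (auto simp: mem_pos_idx_iff[OF mn])
  next
    case False
    then show ?thesis using u(2,4,5)[OF i] clip[OF i] r e[OF i]
      by (cases "i \<le> pos_count A"; cases "pos_count A' < pos_count A") auto
  qed
qed

lemma eps_update_le:
  assumes ord: "ordered_eps A e" and i: "i \<in> {1..CARD('m)}"
  shows "e' i \<le> e i"
proof -
  have "\<mu> * e i \<le> e i" using ord i \<mu> by (simp add: ordered_eps_def less_eq_real_def)
  moreover have "\<mu> * min (e i) b \<le> \<mu> * e i" for b using \<mu> by simp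
  ultimately show ?thesis
    using eps_update_cases[OF mn upd i] clip_le[of \<mu> A' e e' i]
    by (cases "i \<le> pos_count A"; cases "i \<le> pos_count A'"; cases "pos_count A' < pos_count A")
       (auto split: if_splits intro: order.trans)
qed

lemma eps_update_pos_idx_le:
  assumes i: "i \<in> pos_idx A'"
  shows "e' i \<le> \<mu> * e i"
proof -
  have "i \<in> {1..CARD('m)}" "i \<le> pos_count A'"
    using i pos_count_le[of A'] by (auto simp: mem_pos_idx_iff[OF mn])
  then show ?thesis
    using eps_update_cases(1,3)[OF mn upd, of i] \<mu> by (cases "i \<le> pos_count A") auto
qed

text \<open>
  Inside \<open>pos_idx A'\<close> and inside \<open>zero_idx A'\<close> every branch of the update is a monotone function of the
  old perturbation, and where two branches meet, at the old number \<open>r\<close> of positive singular values, the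
  minimum with the perturbation at \<open>r\<close> keeps the order. Between the two sets, at the new number \<open>r'\<close>,
  the clipping rule does.
\<close>

lemma eps_update_ordered:
  assumes ord: "ordered_eps A e"
  shows "ordered_eps A' e'"
proof -
  define r r' where "r = pos_count A" and "r' = pos_count A'"
  have P: "pos_idx A = {1..r}" "pos_idx A' = {1..r'}" "zero_idx A = {r<..CARD('m)}" 
    "zero_idx A' = {r'<..CARD('m)}"
    unfolding r_def r'_def by (rule pos_idx_eq[OF mn] zero_idx_eq[OF mn])+
  have rm: "r \<le> CARD('m)" "r' \<le> CARD('m)" unfolding r_def r'_def by (rule pos_count_le)+
  note u = eps_update_cases[OF mn upd, folded r_def r'_def]
  have e_pos: "e j \<le> e i" if "1 \<le> i" "i \<le> j" "j \<le> r" for i j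
    using ord that by (auto simp: ordered_eps_def P monotone_on_def)
  have e_zero: "e j \<le> e i" if "r < i" "i \<le> j" "j \<le> CARD('m)" for i j
    using ord that by (auto simp: ordered_eps_def P monotone_on_def)
  have pos: "antimono_on {1..r'} e'"
  proof (rule monotone_onI)
    fix i j assume ij: "i \<in> {1..r'}" "j \<in> {1..r'}" "i \<le> j"
    then have m: "i \<in> {1..CARD('m)}" "j \<in> {1..CARD('m)}" using rm by auto
    consider "j \<le> r" | "i \<le> r" "r < j" | "r < i" by linarith
    then show "e' j \<le> e' i"
    proof cases
      case 1
      then show ?thesis using u(1)[OF m(1)] u(1)[OF m(2)] ij e_pos[of i j] \<mu> by simp
    next
      case 2
      have "min (e j) (e r) \<le> e i" using e_pos[of i r] 2 ij by auto
      then show ?thesis using u(1)[OF m(1)] u(3)[OF m(2)] ij 2 \<mu> by auto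
    next
      case 3
      then show ?thesis using u(3)[OF m(1)] u(3)[OF m(2)] ij e_zero[of i j] m \<mu> by auto
    qed
  qed
  have zero: "antimono_on {r'<..CARD('m)} e'"
  proof (rule monotone_onI)
    fix i j assume ij: "i \<in> {r'<..CARD('m)}" "j \<in> {r'<..CARD('m)}" "i \<le> j"
    then have m: "i \<in> {1..CARD('m)}" "j \<in> {1..CARD('m)}" by auto
    show "e' j \<le> e' i"
    proof (cases "r \<le> r'")
      case True
      then have "clip \<mu> A' e e' j \<le> clip \<mu> A' e e' i"
        using e_zero[of i j] ij by (intro clip_mono) auto
      then show ?thesis using u(4)[OF m(1)] u(4)[OF m(2)] ij True by auto
    next
      case r: False
      have shrunk: "e' b \<le> e' a" if "r' < a" "a \<le> b" "b \<le> r" for a b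
        using u(2)[of a] u(2)[of b] that rm clip_mono[OF e_pos[of a b], of \<mu> A' e'] by auto
      consider "j \<le> r" | "i \<le> r" "r < j" | "r < i" by linarith
      then show ?thesis
      proof cases
        case 1
        then show ?thesis using shrunk[of i j] ij by auto
      next
        case 2
        have "e' j \<le> e' r" using u(5)[OF m(2)] 2 r by auto
        also have "\<dots> \<le> e' i" using shrunk[of i r] 2 ij by auto
        finally show ?thesis .
      next
        case 3
        then show ?thesis using u(5)[OF m(1)] u(5)[OF m(2)] r ij e_zero[of i j] by auto
      qed
    qed
  qed
  have "antimono_on {1..CARD('m)} (\<lambda>i. sing_val i A' + e' i)"
  proof (rule antimono_on_atLeastAtMost_joinI[of r'])
    have s: "antimono_on {1..CARD('m)} (\<lambda>i. sing_val i A')" by (rule sing_val_antimono[OF mn])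
    show "antimono_on {1..r'} (\<lambda>i. sing_val i A' + e' i)"
      using pos s rm by (auto simp: monotone_on_def intro!: add_mono)
    show "antimono_on {r'<..CARD('m)} (\<lambda>i. sing_val i A' + e' i)"
      using zero s by (auto simp: monotone_on_def intro!: add_mono)
    assume r': "1 \<le> r'" "Suc r' \<le> CARD('m)"
    have "0 \<le> sing_val r' A' + e' r'"
      using eps_update_pos[OF ord, of r'] sing_val_nonneg[OF mn, of r' A'] r' by simp
    then have c: "clip \<mu> A' e e' (Suc r') \<le> sing_val r' A' + e' r'"
      using clip_Suc_pos_count_le[OF \<mu>, of A' e' e] r' by (auto simp: r'_def)
    have "e' (Suc r') = clip \<mu> A' e e' (Suc r')"
      using u(2)[of "Suc r'"] u(4)[of "Suc r'"] r' by (cases "r \<le> r'") auto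
    then show "sing_val (Suc r') A' + e' (Suc r') \<le> sing_val r' A' + e' r'"
      using c sing_val_zero[OF mn, of "Suc r'" A'] r' by (auto simp: r'_def)
  qed
  then show ?thesis
    using eps_update_pos[OF ord] pos zero unfolding ordered_eps_def P by blast
qed

text \<open>
  Strict order of \<open>e\<close> up to both the old and the new number of positive singular values makes the
  minimum for a newly positive index equal to \<open>e i\<close>, so all of \<open>pos_idx A'\<close> is scaled by \<open>\<mu>\<close>.
\<close>

lemma eps_update_strict:
  assumes strict: "strict_antimono_on (pos_idx A \<union> pos_idx A') e"
  shows "strict_antimono_on (pos_idx A') e'"
proof (rule monotone_onI)
  fix i j assume ij: "i \<in> pos_idx A'" "j \<in> pos_idx A'" "i < j"
  define r where "r = pos_count A"
  have P: "pos_idx A = {1..r}" unfolding r_def by (rule pos_idx_eq[OF mn])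
  have eq: "e' l = \<mu> * e l" if l: "l \<in> pos_idx A'" for l
  proof -
    have l': "l \<in> {1..CARD('m)}" "l \<le> pos_count A'"
      using l pos_count_le[of A'] by (auto simp: mem_pos_idx_iff[OF mn])
    show ?thesis
    proof (cases "l \<le> r \<or> r = 0")
      case False
      then have "r \<in> pos_idx A" "r < l" by (auto simp: P)
      then have "e l < e r" using strict l by (auto simp: monotone_on_def)
      then show ?thesis
        using eps_update_cases(3)[OF mn upd, of l, folded r_def] False l' by auto
    qed (use eps_update_cases(1,3)[OF mn upd, of l, folded r_def] l' in auto)
  qed
  have "e j < e i" using strict ij by (auto simp: monotone_on_def)
  then show "e' j < e' i" using eq ij \<mu> by simp
qed

end

lemma strict_antimono_on_perturbed:
  fixes A :: "real^'n^'m"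
  assumes "CARD('m) \<le> CARD('n)" and strict: "strict_antimono_on (pos_idx A) e"
  shows "strict_antimono_on (pos_idx A) (\<lambda>i. sing_val i A + e i)"
proof (rule monotone_onI)
  fix i j assume ij: "i \<in> pos_idx A" "j \<in> pos_idx A" "i < j"
  then have "sing_val j A \<le> sing_val i A"
    using sing_val_antimono[OF assms(1), of A] by (auto simp: monotone_on_def pos_idx_def)
  moreover have "e j < e i" using strict ij by (auto simp: monotone_on_def)
  ultimately show "sing_val j A + e j < sing_val i A + e i" by simp
qed

lemma ordered_eps_start:
  fixes A :: "real^'n^'m"
  assumes "CARD('m) \<le> CARD('n)" "\<forall>i\<in>{1..CARD('m)}. 0 < e i" "antimono_on {1..CARD('m)} e"
  shows "ordered_eps A e"
  using assms sing_val_antimono[OF assms(1), of A] unfolding ordered_eps_def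
  by (auto simp: monotone_on_def pos_idx_def zero_idx_def intro!: add_mono)

lemma perturbed_sing_val_pos:
  fixes A :: "real^'n^'m"
  assumes "CARD('m) \<le> CARD('n)" "ordered_eps A e" "i \<in> {1..CARD('m)}"
  shows "0 < sing_val i A + e i"
  using assms sing_val_nonneg[OF assms(1), of i A] by (auto simp: ordered_eps_def intro: add_nonneg_pos)

lemma weight_pos_mono:
  fixes A :: "real^'n^'m"
  assumes mn: "CARD('m) \<le> CARD('n)" and p: "0 < p" "p < 1" and ord: "ordered_eps A e"
  shows "\<forall>i\<in>{1..CARD('m)}. 0 < weight p A e i" "mono_on {1..CARD('m)} (weight p A e)"
proof -
  show "\<forall>i\<in>{1..CARD('m)}. 0 < weight p A e i"
    using perturbed_sing_val_pos[OF mn ord] p by (force simp: weight_def)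
  show "mono_on {1..CARD('m)} (weight p A e)"
  proof (rule monotone_onI)
    fix i j assume ij: "i \<in> {1..CARD('m)}" "j \<in> {1..CARD('m)}" "i \<le> j"
    then have "sing_val j A + e j \<le> sing_val i A + e i"
      using ord by (auto simp: ordered_eps_def monotone_on_def)
    then show "weight p A e i \<le> weight p A e j"
      using perturbed_sing_val_pos[OF mn ord ij(2)] p
      by (auto simp: weight_def intro!: mult_left_mono powr_mono2')
  qed
qed

section \<open>Quadratic bounds from a Lipschitz gradient\<close>

lemma GDERIV_line:
  assumes "\<And>x. GDERIV f x :> g x"
  shows "((\<lambda>t. f (y + t *\<^sub>R d)) has_real_derivative (g (y + t *\<^sub>R d) \<bullet> d)) (at t)"
proof -
  have "((\<lambda>t. y + t *\<^sub>R d) has_derivative (\<lambda>h. h *\<^sub>R d)) (at t)"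
    by (auto intro!: derivative_eq_intros)
  from has_derivative_compose[OF this assms[unfolded gderiv_def]]
  have "((\<lambda>t. f (y + t *\<^sub>R d)) has_derivative (\<lambda>h. (h *\<^sub>R d) \<bullet> g (y + t *\<^sub>R d))) (at t)" .
  moreover have "(\<lambda>h. (h *\<^sub>R d) \<bullet> g (y + t *\<^sub>R d)) = (*) (g (y + t *\<^sub>R d) \<bullet> d)"
    by (auto simp: inner_commute)
  ultimately show ?thesis unfolding has_field_derivative_def by metis
qed

text \<open>
  On the segment from \<open>y\<close> to \<open>x\<close> the difference of the two sides has a nonpositive derivative.
\<close>

lemma descent_lemma:
  assumes f: "\<And>x. GDERIV f x :> g x" and g: "L-lipschitz_on UNIV g"
  shows "f x \<le> f y + g y \<bullet> (x - y) + L / 2 * (norm (x - y))\<^sup>2"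
proof -
  define d where "d = x - y"
  define h where "h t = f (y + t *\<^sub>R d) - t * (g y \<bullet> d) - L / 2 * t\<^sup>2 * (norm d)\<^sup>2" for t :: real
  have "h 1 \<le> h 0"
  proof (rule DERIV_nonpos_imp_nonincreasing[of 0 1 h])
    fix t :: real assume t: "0 \<le> t" "t \<le> 1"
    have "(h has_real_derivative (g (y + t *\<^sub>R d) \<bullet> d - g y \<bullet> d - L * t * (norm d)\<^sup>2)) (at t)"
      unfolding h_def by (auto intro!: derivative_eq_intros GDERIV_line[OF f])
    moreover have "g (y + t *\<^sub>R d) \<bullet> d - g y \<bullet> d \<le> L * t * (norm d)\<^sup>2"
    proof -
      have "g (y + t *\<^sub>R d) \<bullet> d - g y \<bullet> d \<le> norm (g (y + t *\<^sub>R d) - g y) * norm d"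
        using norm_cauchy_schwarz[of "g (y + t *\<^sub>R d) - g y" d] by (simp add: inner_diff_left)
      also have "\<dots> \<le> (L * norm (t *\<^sub>R d)) * norm d"
        using lipschitz_onD[OF g, of "y + t *\<^sub>R d" y] by (intro mult_right_mono) (auto simp: dist_norm)
      finally show ?thesis using t by (simp add: power2_eq_square mult_ac)
    qed
    ultimately show "\<exists>z. (h has_real_derivative z) (at t) \<and> z \<le> 0"
      by (intro exI[of _ "g (y + t *\<^sub>R d) \<bullet> d - g y \<bullet> d - L * t * (norm d)\<^sup>2"]) simp
  qed simp
  then show ?thesis by (simp add: h_def d_def)
qed

lemma ascent_lemma:
  assumes f: "\<And>x. GDERIV f x :> g x" and g: "L-lipschitz_on UNIV g"
  shows "f y + g y \<bullet> (x - y) - L / 2 * (norm (x - y))\<^sup>2 \<le> f x"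
proof -
  have "L-lipschitz_on UNIV (\<lambda>x. - g x)"
    using g by (auto simp: lipschitz_on_def dist_norm norm_minus_commute)
  from descent_lemma[OF GDERIV_minus[OF f] this, of x y] show ?thesis by simp
qed

lemma convex_above_tangent:
  assumes f: "\<And>x. GDERIV f x :> g x" and conv: "convex_on UNIV f"
  shows "f y + g y \<bullet> (x - y) \<le> f x"
proof -
  define d where "d = x - y"
  have "convex_on UNIV (\<lambda>t. f (y + t *\<^sub>R d))"
  proof (rule convex_onI)
    fix t a b :: real assume t: "0 < t" "t < 1"
    have "y + ((1 - t) *\<^sub>R a + t *\<^sub>R b) *\<^sub>R d = (1 - t) *\<^sub>R (y + a *\<^sub>R d) + t *\<^sub>R (y + b *\<^sub>R d)"
      by (simp add: algebra_simps)
    then show "f (y + ((1 - t) *\<^sub>R a + t *\<^sub>R b) *\<^sub>R d) \<le> (1 - t) * f (y + a *\<^sub>R d) + t * f (y + b *\<^sub>R d)"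
      using convex_onD[OF conv, of t "y + a *\<^sub>R d" "y + b *\<^sub>R d"] t by simp
  qed simp
  moreover have "((\<lambda>t. f (y + t *\<^sub>R d)) has_real_derivative (g y \<bullet> d)) (at 0)"
    using GDERIV_line[OF f, of y d 0] by simp
  ultimately have "(g y \<bullet> d) * (1 - 0) \<le> f (y + 1 *\<^sub>R d) - f (y + 0 *\<^sub>R d)"
    by (intro convex_on_imp_above_tangent[where A = UNIV]) auto
  then show ?thesis by (simp add: d_def)
qed

text \<open>
  Concavity of \<open>t \<mapsto> t powr p\<close>, obtained from the weighted inequality between geometric and
  arithmetic mean of \<open>b\<close> and \<open>a\<close> after division by \<open>a powr (1 - p)\<close>.
\<close>

lemma powr_le_tangent:
  fixes a b p :: real
  assumes "0 < a" "0 < b" "0 < p" "p < 1"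
  shows "b powr p \<le> a powr p + p * a powr (p - 1) * (b - a)"
proof -
  have "b powr p = (b powr p * a powr (1 - p)) * a powr (p - 1)"
    using assms by (simp add: mult.assoc flip: powr_add)
  also have "\<dots> \<le> (p * b + (1 - p) * a) * a powr (p - 1)"
    using assms by (intro mult_right_mono Youngs_inequality_0) auto
  also have "\<dots> = a * a powr (p - 1) + p * a powr (p - 1) * (b - a)"
    by (simp add: algebra_simps)
  also have "a * a powr (p - 1) = a powr p"
    using assms powr_add[of a 1 "p - 1"] by simp
  finally show ?thesis .
qed

section \<open>Decreasing sequences that are scaled infinitely often\<close>

text \<open>
  A positive limit \<open>l\<close> is impossible: close to the limit a single scaling by \<open>\<mu>\<close> would drop below \<open>l\<close>.
\<close>

lemma decseq_scaled_tendsto_0: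
  fixes e :: "nat \<Rightarrow> real"
  assumes "decseq e" and pos: "\<And>k. 0 \<le> e k" and \<mu>: "0 < \<mu>" "\<mu> < 1"
    and inf: "\<exists>\<^sub>\<infinity>k. e (Suc k) \<le> \<mu> * e k"
  shows "e \<longlonglongrightarrow> 0"
proof -
  obtain l where l: "e \<longlonglongrightarrow> l" "\<And>k. l \<le> e k"
    using decseq_convergent[OF assms(1), of 0] pos by blast
  have "l = 0"
  proof (rule ccontr)
    assume "l \<noteq> 0"
    moreover have "0 \<le> l" using l(1) pos by (intro LIMSEQ_le_const) auto
    ultimately have "l < l / \<mu>" using \<mu> by (simp add: field_simps)
    then have "\<forall>\<^sub>F k in sequentially. e k < l / \<mu>" using order_tendstoD(2)[OF l(1)] by blast
    then obtain K where K: "\<And>k. K \<le> k \<Longrightarrow> e k < l / \<mu>" by (auto simp: eventually_sequentially)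
    obtain k where "K \<le> k" "e (Suc k) \<le> \<mu> * e k" using inf by (auto simp: INFM_nat_le)
    then show False using K[of k] l(2)[of "Suc k"] \<mu> by (simp add: field_simps)
  qed
  then show ?thesis using l(1) by simp
qed

text \<open>
  The mechanism behind the stabilisation of the support, for one singular value \<open>s\<close> and its
  perturbation \<open>e\<close>. If \<open>s\<close> is positive infinitely often, then \<open>e\<close> is scaled infinitely often and
  falls below the gap \<open>\<delta>\<close>. From then on a nonpositive \<open>s k\<close> gives \<open>s k + e k < \<delta>\<close> and can never become
  positive again.
\<close>

lemma eventually_positive_or_zero:
  fixes e s :: "nat \<Rightarrow> real"
  assumes "decseq e" and pos: "\<And>k. 0 \<le> e k" and \<mu>: "0 < \<mu>" "\<mu> < 1" and "0 < \<delta>"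
    and scaled: "\<And>k. 0 < s (Suc k) \<Longrightarrow> e (Suc k) \<le> \<mu> * e k"
    and gap: "\<And>k. 0 < s (Suc k) \<Longrightarrow> \<delta> \<le> s k + e k"
  shows "(\<forall>\<^sub>F k in sequentially. 0 < s k) \<or> (\<forall>\<^sub>F k in sequentially. \<not> 0 < s k)"
proof (rule disjCI)
  assume "\<not> (\<forall>\<^sub>F k in sequentially. \<not> 0 < s k)"
  then have inf: "\<exists>k\<ge>K. 0 < s k" for K by (auto simp: eventually_sequentially)
  have "\<exists>\<^sub>\<infinity>k. e (Suc k) \<le> \<mu> * e k"
    unfolding INFM_nat_le
  proof
    fix K
    obtain k where "Suc K \<le> k" "0 < s k" using inf by blast
    then show "\<exists>n\<ge>K. e (Suc n) \<le> \<mu> * e n" using scaled by (cases k) auto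
  qed
  then have "e \<longlonglongrightarrow> 0" using decseq_scaled_tendsto_0 assms by blast
  then obtain K where K: "\<And>k. K \<le> k \<Longrightarrow> e k < \<delta>"
    using \<open>0 < \<delta>\<close> order_tendstoD(2)[of e 0 sequentially \<delta>] by (auto simp: eventually_sequentially)
  have "0 < s k" if "K \<le> k" for k
  proof (rule ccontr)
    assume "\<not> 0 < s k"
    have "\<not> 0 < s j" if "k \<le> j" for j
      using that
    proof (induction j rule: dec_induct)
      case (step j)
      then show ?case using gap[of j] K[of j] \<open>K \<le> k\<close> by force
    qed fact
    then show False using inf[of k] by blast
  qed
  then show "\<forall>\<^sub>F k in sequentially. 0 < s k" by (auto simp: eventually_sequentially)
qed

section \<open>The iterates\<close>

locale EIRNRI_run =
  fixes f :: "real^'n^'m \<Rightarrow> real" and g :: "real^'n^'m \<Rightarrow> real^'n^'m"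
    and X :: "nat \<Rightarrow> real^'n^'m" and \<epsilon> :: "nat \<Rightarrow> nat \<Rightarrow> real" and \<alpha> :: "nat \<Rightarrow> real"
    and lam p L \<beta> \<mu> \<alpha>bar :: real
  assumes mn: "CARD('m) \<le> CARD('n)"
    and p: "0 < p" "p < 1" and lam: "0 < lam"
    and f: "\<And>x. GDERIV f x :> g x" and g: "L-lipschitz_on UNIV g"
    and level_bounded: "filterlim (objective f lam p) at_top at_infinity"
    and \<beta>: "L < \<beta>" and \<mu>: "0 < \<mu>" "\<mu> < 1"
    and \<alpha>bar: "0 < \<alpha>bar"
      "(convex_on UNIV f \<and> \<alpha>bar < 1) \<or> \<alpha>bar < sqrt (\<beta> / (\<beta> + 3 * L))"
    and run: "EIRNRI f g lam p \<beta> \<mu> \<alpha>bar \<alpha> X \<epsilon>"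
begin

lemma L_nonneg: "0 \<le> L" using g by (rule lipschitz_on_nonneg)

lemma \<alpha>: "0 \<le> \<alpha> k" "\<alpha> k \<le> \<alpha>bar"
  using run by (auto simp: EIRNRI_def)

lemma upd: "eps_update \<mu> (X k) (X (Suc k)) (\<epsilon> k) (\<epsilon> (Suc k))"
  using run by (simp add: EIRNRI_def)

definition w :: "nat \<Rightarrow> nat \<Rightarrow> real" where "w k = weight p (X k) (\<epsilon> k)"
definition Y :: "nat \<Rightarrow> real^'n^'m" where "Y = extrapolated \<alpha> X"

lemma minimizer:
  "subproblem f g lam \<beta> (w k) (Y k) (X k) (X (Suc k)) \<le> subproblem f g lam \<beta> (w k) (Y k) (X k) Z"
  using run by (simp add: EIRNRI_def w_def Y_def)

lemma ordered: "ordered_eps (X k) (\<epsilon> k)"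
proof (induction k)
  case 0
  show ?case using run by (intro ordered_eps_start[OF mn]) (auto simp: EIRNRI_def)
next
  case (Suc k)
  then show ?case by (rule eps_update_ordered[OF mn \<mu> upd])
qed

lemma eps_pos: "i \<in> {1..CARD('m)} \<Longrightarrow> 0 < \<epsilon> k i"
  using ordered by (simp add: ordered_eps_def)

lemma eps_decseq: "i \<in> {1..CARD('m)} \<Longrightarrow> decseq (\<lambda>k. \<epsilon> k i)"
  by (intro decseq_SucI eps_update_le[OF mn \<mu> upd ordered])

lemma Y_diff: "Y k - X k = \<alpha> k *\<^sub>R (X k - X (k - 1))"
  by (simp add: Y_def extrapolated_def)

definition perturbed :: "nat \<Rightarrow> real" where
  "perturbed k = f (X k) + lam * (\<Sum>i=1..CARD('m). (sing_val i (X k) + \<epsilon> k i) powr p)"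

text \<open>
  The last step enters because extrapolation can increase the objective by a multiple of its squared
  length. For \<open>k = 0\<close> it vanishes, as \<open>k - 1\<close> is then \<open>0\<close>.
\<close>

definition potential :: "nat \<Rightarrow> real" where
  "potential k = perturbed k + \<beta> / 2 * (norm (X k - X (k - 1)))\<^sup>2"

text \<open>
  The constant \<open>c\<close> measures how far \<open>f\<close> may lie below its tangent at the extrapolated point. The rule
  for convex \<open>f\<close> uses \<open>c = 0\<close>, the other rule \<open>c = L\<close>; in both cases the extrapolation is short enough
  for its total cost to be covered by the quadratic term of the potential.
\<close>

lemma extrapolation_cost:
  "\<exists>c\<ge>0. (\<forall>k. f (Y k) + g (Y k) \<bullet> (X k - Y k) - c / 2 * (norm (X k - Y k))\<^sup>2 \<le> f (X k)) \<and>
     (\<beta> + c) * \<alpha>bar\<^sup>2 \<le> \<beta>"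
  using \<alpha>bar(2)
proof
  assume c: "convex_on UNIV f \<and> \<alpha>bar < 1"
  then have "\<alpha>bar\<^sup>2 \<le> 1" using \<alpha>bar(1) by (simp add: power_le_one)
  then have "\<beta> * \<alpha>bar\<^sup>2 \<le> \<beta>" using \<beta> L_nonneg by (intro mult_left_le) auto
  then show ?thesis using convex_above_tangent[OF f] c by (intro exI[of _ 0]) auto
next
  assume "\<alpha>bar < sqrt (\<beta> / (\<beta> + 3 * L))"
  then have "\<alpha>bar\<^sup>2 < (sqrt (\<beta> / (\<beta> + 3 * L)))\<^sup>2"
    using \<alpha>bar(1) by (intro power_strict_mono) auto
  then have "\<alpha>bar\<^sup>2 \<le> \<beta> / (\<beta> + 3 * L)" using \<beta> L_nonneg by simp
  then have "\<alpha>bar\<^sup>2 * (\<beta> + 3 * L) \<le> \<beta>" using \<beta> L_nonneg by (simp add: pos_le_divide_eq)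
  moreover have "(\<beta> + L) * \<alpha>bar\<^sup>2 \<le> (\<beta> + 3 * L) * \<alpha>bar\<^sup>2" using L_nonneg by (intro mult_right_mono) auto
  ultimately have "(\<beta> + L) * \<alpha>bar\<^sup>2 \<le> \<beta>" by (simp add: mult.commute)
  then show ?thesis using ascent_lemma[OF f g] L_nonneg by blast
qed

text \<open>
  The weights are the slopes of the concave penalty, so the weighted sum majorises its change;
  shrinking the perturbations only helps.
\<close>

lemma penalty_descent:
  "(\<Sum>i=1..CARD('m). (sing_val i (X (Suc k)) + \<epsilon> (Suc k) i) powr p)
   \<le> (\<Sum>i=1..CARD('m). (sing_val i (X k) + \<epsilon> k i) powr p)
     + (\<Sum>i=1..CARD('m). w k i * sing_val i (X (Suc k))) - (\<Sum>i=1..CARD('m). w k i * sing_val i (X k))"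
  unfolding sum.distrib[symmetric] sum_subtractf[symmetric]
proof (rule sum_mono)
  fix i assume i: "i \<in> {1..CARD('m)}"
  let ?a = "sing_val i (X k) + \<epsilon> k i" and ?b = "sing_val i (X (Suc k)) + \<epsilon> (Suc k) i"
  have "?b powr p \<le> ?a powr p + p * ?a powr (p - 1) * (?b - ?a)"
    using perturbed_sing_val_pos[OF mn ordered i] p by (intro powr_le_tangent) auto
  also have "p * ?a powr (p - 1) = w k i" by (simp add: w_def weight_def)
  also have "w k i * (?b - ?a) \<le> w k i * (sing_val i (X (Suc k)) - sing_val i (X k))"
    using weight_pos_mono(1)[OF mn p ordered, of k] eps_update_le[OF mn \<mu> upd ordered i, of k] i
    by (intro mult_left_mono) (auto simp: w_def less_imp_le)
  finally show "?b powr p \<le> ?a powr p + w k i * sing_val i (X (Suc k)) - w k i * sing_val i (X k)"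
    by (simp add: algebra_simps)
qed

text \<open>
  The minimiser is compared with the competitor \<open>X k\<close>. In the sum of this inequality, the descent
  lemma for \<open>f\<close> and the majorisation of the penalty, the term in \<open>X (Suc k) - Y k\<close> has the factor
  \<open>L - \<beta> < 0\<close> and is dropped, while the extrapolation error is paid by the quadratic term of the
  potential.
\<close>

lemma potential_decseq: "decseq potential"
proof (rule decseq_SucI)
  fix k
  let ?N = "X (Suc k)" and ?A = "X k" and ?W = "\<lambda>Z. \<Sum>i=1..CARD('m). w k i * sing_val i Z"
  obtain c where c: "0 \<le> c" "f (Y k) + g (Y k) \<bullet> (?A - Y k) - c / 2 * (norm (?A - Y k))\<^sup>2 \<le> f ?A"
    "(\<beta> + c) * \<alpha>bar\<^sup>2 \<le> \<beta>"
    using extrapolation_cost by blast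
  have YA: "(norm (?A - Y k))\<^sup>2 = (\<alpha> k)\<^sup>2 * (norm (?A - X (k - 1)))\<^sup>2"
    using Y_diff[of k] by (simp add: norm_minus_commute[of ?A] power_mult_distrib)
  have "?N \<bullet> g (Y k) + \<beta> / 2 * (norm (?N - Y k))\<^sup>2 + \<beta> / 2 * (norm (?N - ?A))\<^sup>2 + lam * ?W ?N
     \<le> ?A \<bullet> g (Y k) + \<beta> / 2 * (norm (?A - Y k))\<^sup>2 + lam * ?W ?A"
    using minimizer[of k ?A] by (simp add: subproblem_def)
  moreover have "f ?N \<le> f (Y k) + g (Y k) \<bullet> (?N - Y k) + L / 2 * (norm (?N - Y k))\<^sup>2"
    by (rule descent_lemma[OF f g])
  moreover have "L / 2 * (norm (?N - Y k))\<^sup>2 \<le> \<beta> / 2 * (norm (?N - Y k))\<^sup>2"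
    using \<beta> by (intro mult_right_mono) auto
  moreover have "perturbed (Suc k) - f ?N \<le> perturbed k - f ?A + lam * ?W ?N - lam * ?W ?A"
    using mult_left_mono[OF penalty_descent[of k], of lam] lam
    by (simp add: perturbed_def algebra_simps)
  ultimately have "perturbed (Suc k) + \<beta> / 2 * (norm (?N - ?A))\<^sup>2
      \<le> perturbed k + (\<beta> + c) / 2 * (norm (?A - Y k))\<^sup>2"
    using c(2) by (simp add: inner_diff_right inner_commute algebra_simps add_divide_distrib)
  also have "(\<beta> + c) / 2 * (norm (?A - Y k))\<^sup>2 \<le> \<beta> / 2 * (norm (?A - X (k - 1)))\<^sup>2"
  proof -
    have "(\<alpha> k)\<^sup>2 \<le> \<alpha>bar\<^sup>2" using \<alpha> by (intro power_mono) auto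
    then have "(\<beta> + c) * (\<alpha> k)\<^sup>2 \<le> (\<beta> + c) * \<alpha>bar\<^sup>2" using c(1) \<beta> L_nonneg by (intro mult_left_mono) auto
    then have "(\<beta> + c) * (\<alpha> k)\<^sup>2 * (norm (?A - X (k - 1)))\<^sup>2 \<le> \<beta> * (norm (?A - X (k - 1)))\<^sup>2"
      using c(3) by (intro mult_right_mono) auto
    then show ?thesis unfolding YA by (simp add: mult.assoc)
  qed
  finally show "potential (Suc k) \<le> potential k" by (simp add: potential_def)
qed

lemma objective_le_potential: "objective f lam p (X k) \<le> potential 0"
proof -
  have "(\<Sum>i=1..CARD('m). sing_val i (X k) powr p) 
      \<le> (\<Sum>i=1..CARD('m). (sing_val i (X k) + \<epsilon> k i) powr p)"
    using eps_pos p sing_val_nonneg[OF mn] by (intro sum_mono powr_mono2) (auto simp: less_imp_le)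
  then have "objective f lam p (X k) \<le> perturbed k"
    using lam by (simp add: objective_def perturbed_def)
  also have "\<dots> \<le> potential k" using \<beta> L_nonneg by (simp add: potential_def)
  also have "\<dots> \<le> potential 0" using potential_decseq by (simp add: decseq_def)
  finally show ?thesis .
qed

lemma iterates_bounded: obtains B where "0 \<le> B" "\<And>k. norm (X k) \<le> B"
proof -
  have "\<forall>\<^sub>F Z in at_infinity. potential 0 < objective f lam p Z"
    using level_bounded by (simp add: filterlim_at_top_dense)
  then obtain b where b: "\<And>Z. b \<le> norm Z \<Longrightarrow> potential 0 < objective f lam p Z"
    by (auto simp: eventually_at_infinity)
  have "norm (X k) \<le> max b 0" for k
    using b[of "X k"] objective_le_potential[of k] by force
  then show ?thesis using that[of "max b 0"] by simp
qed

text \<open>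
  Lowering the last positive singular value of the minimiser by \<open>t\<close> gains \<open>lam * w k r * t\<close> in the
  penalty, and this gain cannot exceed the loss in the smooth part, which is of order \<open>t\<close>. The
  distance \<open>t\<close> is capped at \<open>1\<close>, so its quadratic term costs at most \<open>\<beta> * t\<close>.
\<close>

lemma weight_le_at_last_positive:
  assumes r: "0 < sing_val r (X (Suc k))" "r \<in> {1..CARD('m)}" "r = pos_count (X (Suc k))"
  shows "lam * w k r \<le> norm (g (Y k)) + \<beta> * norm (X (Suc k) - Y k) + \<beta> * norm (X (Suc k) - X k) + \<beta>"
proof -
  let ?N = "X (Suc k)"
  obtain D where D: "norm D = 1" "\<And>t i. 0 \<le> t \<Longrightarrow> t \<le> sing_val r ?N \<Longrightarrow>
      sing_val i (?N - t *\<^sub>R D) = (if i = r then sing_val r ?N - t else sing_val i ?N)"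
  proof (rule sing_val_lower_last_positive[OF mn r(2)])
    show "sing_val i ?N = 0" if "i \<in> {r<..CARD('m)}" for i
      using that r(3) by (intro sing_val_zero[OF mn]) simp
  qed blast
  define t where "t = min 1 (sing_val r ?N)"
  have t: "0 < t" "t \<le> 1" "t \<le> sing_val r ?N" using r(1) by (auto simp: t_def)
  define Z where "Z = ?N - t *\<^sub>R D"
  have "(\<Sum>i=1..CARD('m). w k i * sing_val i Z)
      = (\<Sum>i=1..CARD('m). w k i * sing_val i ?N - (if i = r then w k r * t else 0))"
    using D(2) t by (intro sum.cong) (auto simp: Z_def algebra_simps)
  then have W: "(\<Sum>i=1..CARD('m). w k i * sing_val i Z)
      = (\<Sum>i=1..CARD('m). w k i * sing_val i ?N) - w k r * t"
    using r(2) by (simp add: sum_subtractf)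
  have quad: "(norm (Z - C))\<^sup>2 = (norm (?N - C))\<^sup>2 - 2 * t * (D \<bullet> (?N - C)) + t\<^sup>2" for C
  proof -
    have "D \<bullet> D = 1" using D(1) by (simp add: norm_eq_1)
    then show ?thesis unfolding power2_norm_eq_inner Z_def
      by (simp add: algebra_simps inner_commute power2_eq_square)
  qed
  let ?G = "g (Y k) + \<beta> *\<^sub>R (?N - Y k) + \<beta> *\<^sub>R (?N - X k)"
  have "0 \<le> subproblem f g lam \<beta> (w k) (Y k) (X k) Z - subproblem f g lam \<beta> (w k) (Y k) (X k) ?N"
    using minimizer[of k Z] by simp
  also have "\<dots> = t * (\<beta> * t - D \<bullet> ?G - lam * w k r)"
  proof -
    define a b where "a = D \<bullet> (?N - Y k)" and "b = D \<bullet> (?N - X k)"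
    have Zg: "Z \<bullet> g (Y k) = ?N \<bullet> g (Y k) - t * (D \<bullet> g (Y k))" by (simp add: Z_def inner_diff_left)
    have DG: "D \<bullet> ?G = D \<bullet> g (Y k) + \<beta> * a + \<beta> * b" by (simp add: inner_add_right a_def b_def)
    show ?thesis unfolding subproblem_def W quad Zg DG a_def[symmetric] b_def[symmetric]
      by (simp add: algebra_simps power2_eq_square)
  qed
  finally have "lam * w k r \<le> \<beta> * t - D \<bullet> ?G" using t(1) by (simp add: zero_le_mult_iff)
  also have "\<dots> \<le> \<beta> + norm ?G"
  proof -
    have "\<bar>D \<bullet> ?G\<bar> \<le> norm ?G" using Cauchy_Schwarz_ineq2[of D ?G] D(1) by simp
    moreover have "\<beta> * t \<le> \<beta>" using t \<beta> L_nonneg by (intro mult_left_le) auto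
    ultimately show ?thesis by linarith
  qed
  also have "norm ?G \<le> norm (g (Y k)) + norm (\<beta> *\<^sub>R (?N - Y k)) + norm (\<beta> *\<^sub>R (?N - X k))"
    by (intro order.trans[OF norm_triangle_ineq] add_right_mono norm_triangle_ineq)
  finally show ?thesis using \<beta> L_nonneg by simp
qed

text \<open>
  The weights increase with the index, so the bound for the last positive singular value covers all
  positive ones, and it is uniform in \<open>k\<close> because the iterates stay in a ball.
\<close>

lemma positive_weights_bounded:
  obtains K where "0 < K" "\<And>k i. i \<in> pos_idx (X (Suc k)) \<Longrightarrow> w k i \<le> K"
proof -
  obtain B where B: "0 \<le> B" "\<And>k. norm (X k) \<le> B" using iterates_bounded by blast
  define R where "R = B + \<alpha>bar * (B + B)"
  have "0 \<le> R" using B(1) \<alpha>bar(1) by (simp add: R_def)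
  have Y: "norm (Y k) \<le> R" for k
  proof -
    have "norm (Y k) \<le> norm (X k) + norm (Y k - X k)" by norm
    also have "norm (Y k - X k) = \<alpha> k * norm (X k - X (k - 1))" using Y_diff[of k] \<alpha> by simp
    also have "\<dots> \<le> \<alpha>bar * (B + B)"
      using \<alpha>[of k] \<alpha>bar(1) B(1) norm_triangle_ineq4[of "X k" "X (k - 1)"] B(2)[of k] B(2)[of "k - 1"]
      by (intro mult_mono) auto
    finally show ?thesis using B(2)[of k] by (simp add: R_def)
  qed
  have gY: "norm (g (Y k)) \<le> norm (g 0) + L * R" for k
  proof -
    have "norm (g (Y k) - g 0) \<le> L * norm (Y k)"
      using lipschitz_onD[OF g, of "Y k" 0] by (simp add: dist_norm)
    also have "\<dots> \<le> L * R" using Y[of k] L_nonneg by (rule mult_left_mono)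
    finally show ?thesis using norm_triangle_sub[of "g (Y k)" "g 0"] by simp
  qed
  define C where "C = norm (g 0) + L * R + \<beta> * (B + R) + \<beta> * (B + B) + \<beta>"
  have "w k i \<le> C / lam" if i: "i \<in> pos_idx (X (Suc k))" for k i
  proof -
    define r where "r = pos_count (X (Suc k))"
    have ir: "1 \<le> i" "i \<le> r" using i by (auto simp: r_def mem_pos_idx_iff[OF mn])
    then have r: "r \<in> {1..CARD('m)}" using pos_count_le[of "X (Suc k)"] by (simp add: r_def)
    have "0 < sing_val r (X (Suc k))" using sing_val_pos_iff[OF mn r] by (simp add: r_def)
    from weight_le_at_last_positive[OF this r r_def]
    have "lam * w k r \<le> norm (g (Y k)) + \<beta> * norm (X (Suc k) - Y k) + \<beta> * norm (X (Suc k) - X k) + \<beta>" .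
    also have "\<dots> \<le> C"
    proof -
      have "norm (X (Suc k) - Y k) \<le> B + R" 
        using norm_triangle_ineq4[of "X (Suc k)" "Y k"] B(2)[of "Suc k"] Y[of k] by simp
      moreover have "norm (X (Suc k) - X k) \<le> B + B" 
        using norm_triangle_ineq4[of "X (Suc k)" "X k"] B(2)[of "Suc k"] B(2)[of k] by simp
      ultimately show ?thesis
        unfolding C_def using gY[of k] \<beta> L_nonneg by (intro add_mono mult_left_mono) auto
    qed
    finally have "w k r \<le> C / lam" using lam by (simp add: field_simps)
    moreover have "w k i \<le> w k r"
      using weight_pos_mono(2)[OF mn p ordered, of k] ir r by (auto simp: w_def monotone_on_def)
    ultimately show ?thesis by simp
  qed
  moreover have "0 < C / lam"
  proof -
    have "0 < C" unfolding C_def using \<beta> L_nonneg B(1) \<open>0 \<le> R\<close> by (intro add_nonneg_pos add_nonneg_nonneg) auto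
    then show ?thesis using lam by simp
  qed
  ultimately show ?thesis using that by blast
qed

text \<open>
  A weight is a decreasing function of the perturbed singular value that blows up at \<open>0\<close>; hence
  bounded weights mean perturbed singular values bounded away from \<open>0\<close>. The gap is the value at which
  the weight equals the bound.
\<close>

lemma perturbed_sing_val_gap:
  obtains \<delta> where "0 < \<delta>"
    "\<And>k i. i \<in> pos_idx (X (Suc k)) \<Longrightarrow> \<delta> \<le> sing_val i (X k) + \<epsilon> k i"
proof -
  obtain K where K: "0 < K" "\<And>k i. i \<in> pos_idx (X (Suc k)) \<Longrightarrow> w k i \<le> K"
    using positive_weights_bounded by blast
  define \<delta> where "\<delta> = (K / p) powr (1 / (p - 1))"
  have "0 < \<delta>" using K(1) p by (simp add: \<delta>_def)
  have \<delta>: "p * \<delta> powr (p - 1) = K" using K(1) p by (simp add: \<delta>_def powr_powr)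
  have "\<delta> \<le> sing_val i (X k) + \<epsilon> k i" if i: "i \<in> pos_idx (X (Suc k))" for k i
  proof (rule ccontr)
    assume "\<not> \<delta> \<le> sing_val i (X k) + \<epsilon> k i"
    moreover have "0 < sing_val i (X k) + \<epsilon> k i"
      using i by (intro perturbed_sing_val_pos[OF mn ordered]) (simp add: pos_idx_def)
    ultimately have "\<delta> powr (p - 1) < (sing_val i (X k) + \<epsilon> k i) powr (p - 1)"
      using p by (intro powr_less_mono2_neg) auto
    then have "K < w k i" using p \<delta> by (simp add: w_def weight_def flip: \<delta>)
    then show False using K(2)[OF i] by simp
  qed
  then show ?thesis using that \<open>0 < \<delta>\<close> by blast
qed

section \<open>Stabilisation of the support and of the perturbations\<close>

lemma support_stabilises:
  obtains r where "\<forall>\<^sub>F k in sequentially. pos_count (X k) = r"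
proof -
  obtain \<delta> where \<delta>: "0 < \<delta>" "\<And>k i. i \<in> pos_idx (X (Suc k)) \<Longrightarrow> \<delta> \<le> sing_val i (X k) + \<epsilon> k i"
    using perturbed_sing_val_gap by blast
  have idx: "i \<in> pos_idx (X k)" if "i \<in> {1..CARD('m)}" "0 < sing_val i (X k)" for i k
    using that by (simp add: pos_idx_def)
  have "(\<forall>\<^sub>F k in sequentially. 0 < sing_val i (X k)) \<or> (\<forall>\<^sub>F k in sequentially. \<not> 0 < sing_val i (X k))"
    if i: "i \<in> {1..CARD('m)}" for i
  proof (rule eventually_positive_or_zero[OF eps_decseq[OF i] _ \<mu> \<delta>(1)])
    show "0 \<le> \<epsilon> k i" for k using eps_pos[OF i] by (simp add: less_imp_le)
    show "\<epsilon> (Suc k) i \<le> \<mu> * \<epsilon> k i" if "0 < sing_val i (X (Suc k))" for k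
      using eps_update_pos_idx_le[OF mn \<mu> upd idx[OF i that]] .
    show "\<delta> \<le> sing_val i (X k) + \<epsilon> k i" if "0 < sing_val i (X (Suc k))" for k
      using \<delta>(2)[OF idx[OF i that]] .
  qed
  then have "\<forall>\<^sub>F k in sequentially. (0 < sing_val i (X k)) = (\<forall>\<^sub>F k in sequentially. 0 < sing_val i (X k))"
    if "i \<in> {1..CARD('m)}" for i
    using that by (cases "\<forall>\<^sub>F k in sequentially. 0 < sing_val i (X k)") auto
  moreover define b where "b i \<longleftrightarrow> (\<forall>\<^sub>F k in sequentially. 0 < sing_val i (X k))" for i
  ultimately have "\<forall>\<^sub>F k in sequentially. (0 < sing_val i (X k)) = b i" if "i \<in> {1..CARD('m)}" for i
    using that by simp
  then have "\<forall>\<^sub>F k in sequentially. \<forall>i\<in>{1..CARD('m)}. (0 < sing_val i (X k)) = b i"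
    by (intro eventually_ball_finite) auto
  then have "\<forall>\<^sub>F k in sequentially. pos_count (X k) = card {i\<in>{1..CARD('m)}. b i}"
  proof eventually_elim
    case (elim k)
    then have "pos_idx (X k) = {i\<in>{1..CARD('m)}. b i}" unfolding pos_idx_def by blast
    then show ?case by simp
  qed
  then show ?thesis by (rule that)
qed

text \<open>
  Once the support is fixed, a reduction at step \<open>k\<close> needs \<open>\<epsilon> k (r + 1) > \<tau> (k + 1) \<ge> \<delta>\<close>, and it makes
  \<open>\<epsilon> (k + 1) (r + 1)\<close> smaller than \<open>\<mu> * \<epsilon> k (r + 1)\<close>. So infinitely many reductions would drive
  this perturbation to \<open>0\<close>, below the threshold that they require.
\<close>

lemma zero_eps_eventually_kept:
  assumes K: "\<And>k. K \<le> k \<Longrightarrow> pos_count (X k) = r"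
  obtains N where "K \<le> N" "\<And>k i. N \<le> k \<Longrightarrow> i \<in> {r<..CARD('m)} \<Longrightarrow> \<epsilon> (Suc k) i = \<epsilon> k i"
proof (cases "r = 0 \<or> r = CARD('m)")
  case True
  \<comment> \<open>If \<open>r = 0\<close> there is no threshold, and if \<open>r = m\<close> no singular value vanishes.\<close>
  have "\<epsilon> (Suc k) i = \<epsilon> k i" if "K \<le> k" "i \<in> {r<..CARD('m)}" for k i
    using eps_update_cases(4)[OF mn upd[of k], of i] K[of k] K[of "Suc k"] that True
    by (auto simp: clip_def)
  then show ?thesis using that by blast
next
  case False
  have "r \<le> CARD('m)" using K[of K] pos_count_le[of "X K"] by simp
  then have r: "r \<in> {1..CARD('m)}" "Suc r \<in> {1..CARD('m)}" using False by auto
  obtain \<delta> where \<delta>: "0 < \<delta>" "\<And>k i. i \<in> pos_idx (X (Suc k)) \<Longrightarrow> \<delta> \<le> sing_val i (X k) + \<epsilon> k i"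
    using perturbed_sing_val_gap by blast
  define \<tau> where "\<tau> k = sing_val r (X k) + \<epsilon> k r" for k
  have \<tau>: "\<delta> \<le> \<tau> k" if "K \<le> k" for k
    unfolding \<tau>_def using \<delta>(2)[of r k] K[of "Suc k"] that r by (simp add: mem_pos_idx_iff[OF mn])
  have step: "\<epsilon> (Suc k) i = (if \<epsilon> k (Suc r) \<le> \<tau> (Suc k) then \<epsilon> k i else min (\<epsilon> k i) (\<mu> * \<tau> (Suc k)))"
    if "K \<le> k" "i \<in> {r<..CARD('m)}" for k i
    using eps_update_cases(4)[OF mn upd[of k], of i] K[of k] K[of "Suc k"] that r
    by (auto simp: clip_def \<tau>_def Let_def)
  have "\<forall>\<^sub>F k in sequentially. \<epsilon> k (Suc r) \<le> \<tau> (Suc k)"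
  proof (rule ccontr)
    assume "\<not> ?thesis"
    then have inf: "\<exists>k\<ge>M. \<tau> (Suc k) < \<epsilon> k (Suc r)" for M by (auto simp: eventually_sequentially not_le)
    have "\<exists>\<^sub>\<infinity>k. \<epsilon> (Suc k) (Suc r) \<le> \<mu> * \<epsilon> k (Suc r)"
      unfolding INFM_nat_le
    proof
      fix M
      obtain k where k: "max K M \<le> k" "\<tau> (Suc k) < \<epsilon> k (Suc r)" using inf by blast
      then have "\<epsilon> (Suc k) (Suc r) \<le> \<mu> * \<tau> (Suc k)" using step[of k "Suc r"] r by auto
      also have "\<dots> \<le> \<mu> * \<epsilon> k (Suc r)" using k \<mu> by simp
      finally show "\<exists>k\<ge>M. \<epsilon> (Suc k) (Suc r) \<le> \<mu> * \<epsilon> k (Suc r)" using k by auto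
    qed
    then have "(\<lambda>k. \<epsilon> k (Suc r)) \<longlonglongrightarrow> 0"
      using eps_decseq[OF r(2)] eps_pos[OF r(2)] \<mu> 
      by (intro decseq_scaled_tendsto_0[where \<mu> = \<mu>]) (auto simp: less_imp_le)
    then obtain M where "\<And>k. M \<le> k \<Longrightarrow> \<epsilon> k (Suc r) < \<delta>"
      using \<delta>(1) order_tendstoD(2)[of _ 0 sequentially \<delta>] by (fastforce simp: eventually_sequentially)
    moreover obtain k where "max K M \<le> k" "\<tau> (Suc k) < \<epsilon> k (Suc r)" using inf by blast
    ultimately show False using \<tau>[of "Suc k"] by force
  qed
  then obtain N where N: "\<And>k. N \<le> k \<Longrightarrow> \<epsilon> k (Suc r) \<le> \<tau> (Suc k)" by (auto simp: eventually_sequentially)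
  have "\<epsilon> (Suc k) i = \<epsilon> k i" if "max K N \<le> k" "i \<in> {r<..CARD('m)}" for k i
    using step[of k i] N[of k] that by simp
  then show ?thesis using that[of "max K N"] by simp
qed

lemma order_properties:
  "antimono_on (pos_idx (X k)) (\<epsilon> k)"
  "antimono_on {1..CARD('m)} (\<lambda>i. sing_val i (X k) + \<epsilon> k i)"
  "antimono_on (zero_idx (X k)) (\<epsilon> k)"
  using ordered[of k] by (auto simp: ordered_eps_def)

lemma strictness_propagates:
  assumes "strict_antimono_on (pos_idx (X k) \<union> pos_idx (X (Suc k))) (\<epsilon> k)"
  shows "strict_antimono_on (pos_idx (X (Suc k))) (\<epsilon> (Suc k))"
    "strict_antimono_on (pos_idx (X (Suc k))) (\<lambda>i. sing_val i (X (Suc k)) + \<epsilon> (Suc k) i)"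
proof -
  show "strict_antimono_on (pos_idx (X (Suc k))) (\<epsilon> (Suc k))"
    using eps_update_strict[OF mn \<mu> upd assms] .
  then show "strict_antimono_on (pos_idx (X (Suc k))) (\<lambda>i. sing_val i (X (Suc k)) + \<epsilon> (Suc k) i)"
    by (rule strict_antimono_on_perturbed[OF mn])
qed

lemma asymptotics:
  "\<exists>Istar Zstar.
     (\<forall>\<^sub>F k in sequentially. pos_idx (X k) = Istar \<and> zero_idx (X k) = Zstar) \<and>
     (\<exists>khat. \<forall>k\<ge>khat. \<forall>i\<in>Istar. \<epsilon> (Suc k) i = \<mu> * \<epsilon> k i) \<and>
     (\<forall>i\<in>Istar. decseq (\<lambda>k. \<epsilon> k i) \<and> (\<lambda>k. \<epsilon> k i) \<longlonglongrightarrow> 0) \<and>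
     (\<exists>khat. (\<forall>k\<ge>khat. \<forall>i\<in>zero_idx (X k). \<epsilon> (Suc k) i = \<epsilon> k i) \<and>
             (\<forall>k\<ge>khat. \<forall>i\<in>Zstar. \<epsilon> k i = \<epsilon> khat i)) \<and>
     (\<forall>i\<in>Zstar. \<exists>c>0. (\<lambda>k. \<epsilon> k i) \<longlonglongrightarrow> c \<and> (\<forall>\<^sub>F k in sequentially. \<epsilon> k i = c))"
proof -
  obtain r where "\<forall>\<^sub>F k in sequentially. pos_count (X k) = r" by (rule support_stabilises)
  then obtain K where K: "\<And>k. K \<le> k \<Longrightarrow> pos_count (X k) = r" by (auto simp: eventually_sequentially)
  obtain N where N: "K \<le> N" "\<And>k i. N \<le> k \<Longrightarrow> i \<in> {r<..CARD('m)} \<Longrightarrow> \<epsilon> (Suc k) i = \<epsilon> k i"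
    using zero_eps_eventually_kept[OF K] by blast
  have idx: "pos_idx (X k) = {1..r}" "zero_idx (X k) = {r<..CARD('m)}" if "K \<le> k" for k
    using pos_idx_eq[OF mn, of "X k"] zero_idx_eq[OF mn, of "X k"] K[OF that] by simp_all
  have rm: "r \<le> CARD('m)" using K[of K] pos_count_le[of "X K"] by simp
  have scaled: "\<epsilon> (Suc k) i = \<mu> * \<epsilon> k i" if "K \<le> k" "i \<in> {1..r}" for k i
    using eps_update_cases(1)[OF mn upd[of k], of i] K[of k] K[of "Suc k"] that rm by auto
  have lim: "decseq (\<lambda>k. \<epsilon> k i) \<and> (\<lambda>k. \<epsilon> k i) \<longlonglongrightarrow> 0" if i: "i \<in> {1..r}" for i
  proof -
    have m: "i \<in> {1..CARD('m)}" using i rm by auto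
    have "\<exists>\<^sub>\<infinity>k. \<epsilon> (Suc k) i \<le> \<mu> * \<epsilon> k i"
      unfolding INFM_nat_le
    proof
      fix M show "\<exists>k\<ge>M. \<epsilon> (Suc k) i \<le> \<mu> * \<epsilon> k i"
        using scaled[of "max K M" i] i by (intro exI[of _ "max K M"]) auto
    qed
    then show ?thesis
      using eps_decseq[OF m] eps_pos[OF m] \<mu>
      by (intro conjI decseq_scaled_tendsto_0[where \<mu> = \<mu>]) (auto simp: less_imp_le)
  qed
  have const: "\<epsilon> k i = \<epsilon> N i" if "N \<le> k" "i \<in> {r<..CARD('m)}" for k i
    using that(1)
  proof (induction k rule: dec_induct)
    case (step k)
    then show ?case using N(2)[of k i] that by simp
  qed simp
  have fixed: "\<exists>c>0. (\<lambda>k. \<epsilon> k i) \<longlonglongrightarrow> c \<and> (\<forall>\<^sub>F k in sequentially. \<epsilon> k i = c)" if i: "i \<in> {r<..CARD('m)}" for i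
  proof -
    have "\<forall>\<^sub>F k in sequentially. \<epsilon> k i = \<epsilon> N i" unfolding eventually_sequentially using const i by blast
    moreover from this have "(\<lambda>k. \<epsilon> k i) \<longlonglongrightarrow> \<epsilon> N i" by (rule tendsto_eventually)
    moreover have "0 < \<epsilon> N i" using i by (intro eps_pos) auto
    ultimately show ?thesis by blast
  qed
  have "\<forall>\<^sub>F k in sequentially. pos_idx (X k) = {1..r} \<and> zero_idx (X k) = {r<..CARD('m)}"
    unfolding eventually_sequentially using idx by blast
  moreover have "\<exists>khat. \<forall>k\<ge>khat. \<forall>i\<in>{1..r}. \<epsilon> (Suc k) i = \<mu> * \<epsilon> k i"
    using scaled by blast
  moreover have "\<exists>khat. (\<forall>k\<ge>khat. \<forall>i\<in>zero_idx (X k). \<epsilon> (Suc k) i = \<epsilon> k i) \<and>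
      (\<forall>k\<ge>khat. \<forall>i\<in>{r<..CARD('m)}. \<epsilon> k i = \<epsilon> khat i)"
  proof (intro exI conjI allI impI ballI)
    fix k i assume k: "N \<le> k"
    show "\<epsilon> (Suc k) i = \<epsilon> k i" if "i \<in> zero_idx (X k)"
      using N(2)[OF k] that idx(2)[OF order.trans[OF N(1) k]] by simp
    show "\<epsilon> k i = \<epsilon> N i" if "i \<in> {r<..CARD('m)}" using const[OF k that] .
  qed
  ultimately show ?thesis using lim fixed by blast
qed

end

section \<open>The theorem on the perturbations\<close>

theorem theorem3p3:
  fixes f :: "real^'n^'m \<Rightarrow> real"
    and g :: "real^'n^'m \<Rightarrow> real^'n^'m"
    and X :: "nat \<Rightarrow> real^'n^'m"
    and \<epsilon> :: "nat \<Rightarrow> nat \<Rightarrow> real"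
    and \<alpha> :: "nat \<Rightarrow> real"
    and lam p L \<beta> \<mu> \<alpha>bar :: real
  assumes "CARD('m) \<le> CARD('n)"
    and "0 < p" "p < 1" "0 < lam"
    and "C2_with_gradient f g"
    and "L-lipschitz_on UNIV g"
    and "filterlim (objective f lam p) at_top at_infinity"
    and "L < \<beta>" "0 < \<mu>" "\<mu> < 1"
    and "0 < \<alpha>bar"
    and "(convex_on UNIV f \<and> \<alpha>bar < 1) \<or> \<alpha>bar < sqrt (\<beta> / (\<beta> + 3 * L))"
    and "EIRNRI f g lam p \<beta> \<mu> \<alpha>bar \<alpha> X \<epsilon>"
  shows
    "(\<forall>k. antimono_on (pos_idx (X k)) (\<epsilon> k) \<and>
          antimono_on {1..CARD('m)} (\<lambda>i. sing_val i (X k) + \<epsilon> k i) \<and>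
          antimono_on (zero_idx (X k)) (\<epsilon> k)) \<and>
     (\<forall>k. strict_antimono_on (pos_idx (X k) \<union> pos_idx (X (Suc k))) (\<epsilon> k) \<longrightarrow>
          strict_antimono_on (pos_idx (X (Suc k))) (\<epsilon> (Suc k)) \<and>
          strict_antimono_on (pos_idx (X (Suc k)))
            (\<lambda>i. sing_val i (X (Suc k)) + \<epsilon> (Suc k) i)) \<and>
     (\<forall>k. (\<forall>i\<in>{1..CARD('m)}. 0 < weight p (X k) (\<epsilon> k) i) \<and>
          mono_on {1..CARD('m)} (weight p (X k) (\<epsilon> k))) \<and>
     (\<exists>Istar Zstar.
        (\<forall>\<^sub>F k in sequentially. pos_idx (X k) = Istar \<and> zero_idx (X k) = Zstar) \<and>
        (\<exists>khat. \<forall>k\<ge>khat. \<forall>i\<in>Istar. \<epsilon> (Suc k) i = \<mu> * \<epsilon> k i) \<and>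
        (\<forall>i\<in>Istar. decseq (\<lambda>k. \<epsilon> k i) \<and> (\<lambda>k. \<epsilon> k i) \<longlonglongrightarrow> 0) \<and>
        (\<exists>khat. (\<forall>k\<ge>khat. \<forall>i\<in>zero_idx (X k). \<epsilon> (Suc k) i = \<epsilon> k i) \<and>
                (\<forall>k\<ge>khat. \<forall>i\<in>Zstar. \<epsilon> k i = \<epsilon> khat i)) \<and>
        (\<forall>i\<in>Zstar. \<exists>c>0. (\<lambda>k. \<epsilon> k i) \<longlonglongrightarrow> c \<and> (\<forall>\<^sub>F k in sequentially. \<epsilon> k i = c)))"
proof -
  interpret EIRNRI_run f g X \<epsilon> \<alpha> lam p L \<beta> \<mu> \<alpha>bar
    using assms unfolding C2_with_gradient_def by unfold_locales blast+
  show ?thesis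
    using order_properties strictness_propagates weight_pos_mono[OF mn p ordered] asymptotics
    by blast
qed

end
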